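(* Let $n\ge 2$ and $\sigma=(n-1)/2$. There is a constant $A_n>0$ depending only on $n$ such that for every $0<\delta<1/2$, every finite family $\mathcal{B}$ of balls in $\mathbb{R}^n$ has a subfamily $\mathcal{S}\subset\mathcal{B}$ such that $$\bigcup_{B\in\mathcal{B}}B\subset\bigcup_{B\in\mathcal{S}}(1+\delta)B$$ and $$\sum_{B\in\mathcal{S}}\mathbf{1}_B(x)\le A_n\,\delta^{-\sigma}\qquad\text{for all }x\in\mathbb{R}^n.$$ Moreover, the exponent $\sigma=(n-1)/2$ is optimal, even for families of equal-radius balls: there are no $\tau<\sigma$ and $A>0$ such that, for every $0<\delta<1/2$, every finite family $\mathcal{B}$ of balls in $\mathbb{R}^n$ all having the same radius has a subfamily $\mathcal{S}\subset\mathcal{B}$ with $\bigcup_{B\in\mathcal{B}}B\subset\bigcup_{B\in\mathcal{S}}(1+\delta)B$ and $\sum_{B\in\mathcal{S}}\mathbf{1}_B(x)\le A\,\delta^{-\tau}$ for all $x\in\mathbb{R}^n$.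
   Context: All balls are open Euclidean balls $B(c,r)=\{x\in\mathbb{R}^n:|x-c|<r\}$ with positive radius $r$. For $a>0$, $aB(c,r)=B(c,ar)$. $\mathbf{1}_B$ denotes the indicator function of $B$. *)

theory Defs
  imports "HOL-Analysis.Analysis"
begin

text \<open>
  A ball is encoded by its centre and radius, so that dilation and ``equal radius'' are
  defined without choosing a centre. Over nontrivial Euclidean spaces, an open ball of
  positive radius determines both data, so finite sets of such pairs are the same thing as
  finite sets of balls.
\<close>

type_synonym 'n eball = "(real ^ 'n) \<times> real"

definition points :: "'n::finite eball \<Rightarrow> (real ^ 'n) set" where
  "points B = ball (fst B) (snd B)"

definition dilate :: "real \<Rightarrow> 'n::finite eball \<Rightarrow> 'n eball" where
  "dilate a B = (fst B, a * snd B)"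

definition finite_ball_family :: "'n::finite eball set \<Rightarrow> bool" where
  "finite_ball_family \<B> \<longleftrightarrow> finite \<B> \<and> (\<forall>B\<in>\<B>. snd B > 0)"

definition equal_radii :: "'n::finite eball set \<Rightarrow> bool" where
  "equal_radii \<B> \<longleftrightarrow> (\<exists>r. \<forall>B\<in>\<B>. snd B = r)"

end

theory Submission
  imports Defs
begin

text \<open>
  Upper bound. Group the balls into dyadic size classes and go from large to small radii. As long
  as some ball is not covered, take an uncovered point \<open>z\<close> of a ball of the largest possible class and
  select the ball of that class in which \<open>z\<close> lies deepest.

  Within a class, move the witness \<open>z\<close> along its radius to a prescribed depth. By maximality of the depth
  these rays are monotone, as in the Bronshtein-Ivanov theorem on polytope approximation, and
  two rays at distance less than a multiple of \<open>sqrt \<delta>\<close> would make one of the balls redundant. The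
  rays are thus disjoint tubes, and comparing volumes gives \<open>\<delta> powr (- (n - 1) / 2)\<close> for one class; if
  the witnesses lie in a region of relative size \<open>\<sigma>\<close> around the given point, the tube argument
  at scale \<open>\<sigma>\<close> yields \<open>(\<sigma> / \<delta>) powr ((n - 1) / 2)\<close>.

  To add up the classes of balls containing a given point, say the origin, let \<open>R\<close> be the smallest
  radius. The origin is within \<open>2 R\<close> of the boundary of each larger ball. Witnesses at distance at
  most a multiple of \<open>sqrt (R r)\<close> give a geometric series. Any other witness separates, by the hyperplane
  orthogonal to it, the direction of the centre of its ball from the convex hull of the directions
  belonging to larger balls. The tubes of all classes, rescaled to unit size and pushed away from
  the hull of the previous directions by a fixed amount, are therefore disjoint, so that one
  volume comparison bounds all classes at once.

  Optimality. Unit balls centred at the halves of \<open>sqrt (6 \<delta>)\<close>-separated unit vectors all contain the origin, and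
  none can be omitted.
\<close>

subsection \<open>Packing and greedy selection\<close>

text \<open>Volume comparison: the balls of radius \<open>\<eta>/2\<close> about the points are
  disjoint and lie in a ball of radius \<open>L + \<eta>/2\<close>, at most \<open>3 * L / 2\<close>
  because \<open>\<eta> \<le> L\<close>.\<close>

lemma card_separated_le:
  fixes f :: "'i \<Rightarrow> 'a::euclidean_space"
  assumes "finite I" "0 < \<eta>" "\<eta> \<le> L"
    and bounded: "\<And>i. i \<in> I \<Longrightarrow> norm (f i) \<le> L"
    and separated: "\<And>i j. i \<in> I \<Longrightarrow> j \<in> I \<Longrightarrow> i \<noteq> j \<Longrightarrow> \<eta> \<le> dist (f i) (f j)"
  shows "real (card I) \<le> (3 * L / \<eta>) ^ DIM('a)"
proof -
  let ?V = "unit_ball_vol (real DIM('a))"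
  have V: "?V > 0" by simp
  have disj: "disjoint_family_on (\<lambda>i. ball (f i) (\<eta>/2)) I"
  proof (unfold disjoint_family_on_def, intro ballI impI)
    fix i j assume ij: "i \<in> I" "j \<in> I" "i \<noteq> j"
    show "ball (f i) (\<eta>/2) \<inter> ball (f j) (\<eta>/2) = {}"
    proof (rule disjoint_ballI)
      show "\<eta>/2 + \<eta>/2 \<le> dist (f i) (f j)" using separated[OF ij] by simp
    qed
  qed
  have sub: "(\<Union>i\<in>I. ball (f i) (\<eta>/2)) \<subseteq> ball 0 (3 * L / 2)"
  proof (intro UN_least subsetI)
    fix i y assume "i \<in> I" "y \<in> ball (f i) (\<eta>/2)"
    then have "norm (f i) \<le> L" "norm (y - f i) < \<eta>/2"
      using bounded by (auto simp: dist_norm norm_minus_commute)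
    then have "norm y < L + \<eta>/2" using norm_triangle_ineq2[of y "f i"] by linarith
    then show "y \<in> ball 0 (3 * L / 2)" using assms by (simp add: field_simps)
  qed
  have "real (card I) * (?V * (\<eta>/2) ^ DIM('a)) = (\<Sum>i\<in>I. measure lborel (ball (f i) (\<eta>/2)))"
    using assms by (simp add: content_ball)
  also have "\<dots> = measure lborel (\<Union>i\<in>I. ball (f i) (\<eta>/2))"
    by (rule measure_finite_Union[symmetric])
       (use assms disj in \<open>auto simp: emeasure_ball\<close>)
  also have "\<dots> \<le> measure lborel (ball (0::'a) (3 * L / 2))"
    by (rule measure_mono_fmeasurable) (use sub emeasure_bounded_finite[of "ball (0::'a) (3 * L / 2)"] in
        \<open>auto simp: fmeasurable_def intro!: borel_open\<close>)
  also have "\<dots> = ?V * (3 * L / 2) ^ DIM('a)"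
    using assms by (simp add: content_ball)
  finally have "real (card I) * (\<eta>/2) ^ DIM('a) \<le> (3 * L / 2) ^ DIM('a)"
    using V by (simp add: mult.left_commute)
  then have "real (card I) \<le> (3 * L / 2) ^ DIM('a) / (\<eta>/2) ^ DIM('a)"
    using assms by (simp add: pos_le_divide_eq)
  also have "\<dots> = (3 * L / \<eta>) ^ DIM('a)"
    unfolding power_divide[symmetric] by simp
  finally show ?thesis .
qed

text \<open>The recursion over classes is replaced by a maximal set: among all \<open>S\<close> that
  satisfy the invariant \<open>Q\<close> one of largest cardinality is taken, and an uncovered point
  would allow it to grow. The disjunction in the last conclusion forgets which of two balls of a
  class was selected first; the later one has its witness outside the dilate of the earlier
  one.\<close>

lemma greedy_selection:
  fixes c :: "'i \<Rightarrow> 'a::euclidean_space" and r :: "'i \<Rightarrow> real" and cl :: "'i \<Rightarrow> 'k::linorder"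
  assumes fin: "finite I" and "0 \<le> \<delta>"
  obtains S z where "S \<subseteq> I"
    "(\<Union>i\<in>I. ball (c i) (r i)) \<subseteq> (\<Union>i\<in>S. ball (c i) ((1 + \<delta>) * r i))"
    "\<And>i. i \<in> S \<Longrightarrow> norm (z i - c i) < r i"
    "\<And>i j. i \<in> S \<Longrightarrow> j \<in> I \<Longrightarrow> cl j = cl i \<Longrightarrow> norm (z i - c i) - r i \<le> norm (z i - c j) - r j"
    "\<And>i j. i \<in> S \<Longrightarrow> j \<in> S \<Longrightarrow> cl i < cl j \<Longrightarrow> (1 + \<delta>) * r j \<le> norm (z i - c j)"
    "\<And>i j. i \<in> S \<Longrightarrow> j \<in> S \<Longrightarrow> cl i = cl j \<Longrightarrow> i \<noteq> j \<Longrightarrow>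
       (1 + \<delta>) * r j \<le> norm (z i - c j) \<or> (1 + \<delta>) * r i \<le> norm (z j - c i)"
proof -
  define cover where "cover S = (\<Union>i\<in>S. ball (c i) ((1 + \<delta>) * r i))" for S
  \<comment> \<open>The last clause records that a class is opened only after all higher classes are
    covered. It forces every member of \<open>S\<close> to have class at least that of the ball to
    be added, so no old witness has to be compared with the new ball as a higher one.\<close>
  define Q where "Q S z \<longleftrightarrow> S \<subseteq> I \<and>
    (\<forall>i\<in>S. norm (z i - c i) < r i) \<and>
    (\<forall>i\<in>S. \<forall>j\<in>I. cl j = cl i \<longrightarrow> norm (z i - c i) - r i \<le> norm (z i - c j) - r j) \<and>
    (\<forall>i\<in>S. \<forall>j\<in>S. cl i < cl j \<longrightarrow> (1 + \<delta>) * r j \<le> norm (z i - c j)) \<and>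
    (\<forall>i\<in>S. \<forall>j\<in>S. cl i = cl j \<longrightarrow> i \<noteq> j \<longrightarrow>
       (1 + \<delta>) * r j \<le> norm (z i - c j) \<or> (1 + \<delta>) * r i \<le> norm (z j - c i)) \<and>
    (\<forall>i\<in>S. \<forall>j\<in>I. cl i < cl j \<longrightarrow> ball (c j) (r j) \<subseteq> cover S)" for S z
  have Q_empty: "\<exists>z. Q {} z" by (simp add: Q_def)
  have Q_card: "\<forall>S. (\<exists>z. Q S z) \<longrightarrow> card S < Suc (card I)"
    using fin by (auto simp: Q_def less_Suc_eq_le intro: card_mono)
  obtain S where S: "\<exists>z. Q S z" and S_max: "\<And>S'. \<exists>z. Q S' z \<Longrightarrow> card S' \<le> card S"
    using ex_has_greatest_nat[of "\<lambda>S. \<exists>z. Q S z" "{}" card "Suc (card I)", OF Q_empty Q_card] by blast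
  obtain z where z: "Q S z" using S by blast
  have below: "\<And>i j. i \<in> S \<Longrightarrow> j \<in> I \<Longrightarrow> cl i < cl j \<Longrightarrow> ball (c j) (r j) \<subseteq> cover S"
    using z unfolding Q_def by blast
  have "(\<Union>i\<in>I. ball (c i) (r i)) \<subseteq> cover S"
  proof (rule ccontr)
    assume not_covered: "\<not> ?thesis"
    define U where "U = {i \<in> I. \<not> ball (c i) (r i) \<subseteq> cover S}"
    have U: "finite U" "U \<noteq> {}" using not_covered fin by (auto simp: U_def)
    define k where "k = Max (cl ` U)"
    have "k \<in> cl ` U" unfolding k_def by (rule Max_in) (use U in auto)
    then obtain i\<^sub>0 where i0: "i\<^sub>0 \<in> U" "cl i\<^sub>0 = k" by auto
    have above: "ball (c j) (r j) \<subseteq> cover S" if "j \<in> I" "k < cl j" for j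
    proof (rule ccontr)
      assume "\<not> ball (c j) (r j) \<subseteq> cover S"
      then have "cl j \<in> cl ` U" using that by (auto simp: U_def)
      then have "cl j \<le> k" unfolding k_def by (rule Max_ge[rotated]) (use U in auto)
      with that show False by auto
    qed
    obtain p where p: "p \<in> ball (c i\<^sub>0) (r i\<^sub>0)" "p \<notin> cover S"
      using i0 unfolding U_def by blast
    define K where "K = {j \<in> I. cl j = k}"
    have K: "finite K" "i\<^sub>0 \<in> K" using fin i0 by (auto simp: K_def U_def)
    \<comment> \<open>Here \<open>depth\<close> is the signed distance to the sphere, negative
      inside the ball, so its minimiser \<open>b\<close> is the ball in which \<open>p\<close> lies
      deepest.\<close>
    define depth where "depth j = norm (p - c j) - r j" for j
    have "K \<noteq> {}" using K by auto
    then obtain b where b: "b \<in> K" "\<And>j. j \<in> K \<Longrightarrow> depth b \<le> depth j"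
      using arg_min_if_finite[OF K(1), of depth] by (meson not_le)
    have pb: "norm (p - c b) < r b"
      using b(2)[OF K(2)] p(1) by (simp add: depth_def dist_norm norm_minus_commute)
    have p_out: "(1 + \<delta>) * r j \<le> norm (p - c j)" if "j \<in> S" for j
      using p(2) that by (auto simp: cover_def dist_norm norm_minus_commute not_less)
    have ge_k: "k \<le> cl j" if "j \<in> S" for j
    proof (rule ccontr)
      assume "\<not> k \<le> cl j"
      then have "ball (c i\<^sub>0) (r i\<^sub>0) \<subseteq> cover S" using below[of j i\<^sub>0] that i0 by (simp add: U_def not_le)
      with p show False by blast
    qed
    have "b \<notin> S"
    proof
      assume "b \<in> S"
      from p_out[OF this] have "(1 + \<delta>) * r b < r b" using pb by simp
      then have "\<delta> * r b < 0" by (simp add: algebra_simps)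
      then show False using \<open>0 \<le> \<delta>\<close> pb norm_ge_zero[of "p - c b"]
        by (simp add: mult_less_0_iff)
    qed
    have bI: "b \<in> I" "cl b = k" using b by (auto simp: K_def)
    define S' where "S' = insert b S"
    define z' where "z' = z(b := p)"
    have cover_mono: "cover S \<subseteq> cover S'" by (auto simp: cover_def S'_def)
    have z'S: "z' i = z i" if "i \<in> S" for i using that \<open>b \<notin> S\<close> by (auto simp: z'_def)
    have z'b: "z' b = p" by (simp add: z'_def)
    have SI: "S \<subseteq> I" using z by (simp add: Q_def)
    have "Q S' z'"
      unfolding Q_def
    proof (intro conjI ballI impI)
      show "S' \<subseteq> I" using SI bI by (simp add: S'_def)
    next
      fix i assume "i \<in> S'"
      then show "norm (z' i - c i) < r i"
        using z pb z'S z'b by (auto simp: S'_def Q_def)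
    next
      fix i j assume "i \<in> S'" "j \<in> I" "cl j = cl i"
      then show "norm (z' i - c i) - r i \<le> norm (z' i - c j) - r j"
        using z b(2) bI z'S z'b by (auto simp: S'_def Q_def K_def depth_def)
    next
      fix i j assume ij: "i \<in> S'" "j \<in> S'" "cl i < cl j"
      show "(1 + \<delta>) * r j \<le> norm (z' i - c j)"
      proof (cases "i = b")
        case True
        then show ?thesis using ij p_out z'b by (auto simp: S'_def)
      next
        case False
        then have "i \<in> S" "j \<noteq> b" using ij ge_k[of i] bI by (auto simp: S'_def)
        then show ?thesis using ij z z'S by (auto simp: S'_def Q_def)
      qed
    next
      fix i j assume ij: "i \<in> S'" "j \<in> S'" "cl i = cl j" "i \<noteq> j"
      then consider "i = b" "j \<in> S" | "j = b" "i \<in> S" | "i \<in> S" "j \<in> S" by (auto simp: S'_def)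
      then show "(1 + \<delta>) * r j \<le> norm (z' i - c j) \<or> (1 + \<delta>) * r i \<le> norm (z' j - c i)"
        using ij z z'S z'b p_out by cases (auto simp: Q_def)
    next
      fix i j assume ij: "i \<in> S'" "j \<in> I" "cl i < cl j"
      then have "ball (c j) (r j) \<subseteq> cover S" using above below bI unfolding S'_def by blast
      then show "ball (c j) (r j) \<subseteq> cover S'" using cover_mono by blast
    qed
    then have "card S' \<le> card S" using S_max by blast
    moreover have "card S' = Suc (card S)"
      unfolding S'_def using \<open>b \<notin> S\<close> finite_subset[OF SI fin] by simp
    ultimately show False by simp
  qed
  with z show thesis
    by (intro that[of S z]) (auto simp: Q_def cover_def)
qed

subsection \<open>Balls of comparable radii\<close>

text \<open>Since \<open>r i - norm (z i - c i)\<close> is the depth of the witness \<open>z i\<close> in ball \<open>i\<close>, the third line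
  says that \<open>i\<close> is a ball of its size class in which \<open>z i\<close> lies deepest.\<close>

definition witnessed ::
    "real \<Rightarrow> real \<Rightarrow> 'i set \<Rightarrow> ('i \<Rightarrow> 'a::euclidean_space) \<Rightarrow> ('i \<Rightarrow> real) \<Rightarrow> ('i \<Rightarrow> 'a) \<Rightarrow> bool" where
  "witnessed \<delta> \<rho> I c r z \<longleftrightarrow> finite I \<and>
     (\<forall>i\<in>I. \<rho> \<le> r i \<and> r i < 2 * \<rho> \<and> norm (z i - c i) < r i) \<and>
     (\<forall>i\<in>I. \<forall>j\<in>I. norm (z i - c i) - r i \<le> norm (z i - c j) - r j) \<and>
     (\<forall>i\<in>I. \<forall>j\<in>I. i \<noteq> j \<longrightarrow>
        (1 + \<delta>) * r j \<le> norm (z i - c j) \<or> (1 + \<delta>) * r i \<le> norm (z j - c i))"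

text \<open>The point at depth \<open>s\<close> below the sphere on the radius through
  \<open>z\<close>; \<open>s = 0\<close> is on the sphere and \<open>s = r\<close> is the centre.
  Depth is the parameter because it can be compared between balls of different radii. For
  \<open>z = c\<close> the value is \<open>c\<close>, since \<open>sgn 0 = 0\<close>.\<close>

definition level_point :: "'a::euclidean_space \<Rightarrow> real \<Rightarrow> 'a \<Rightarrow> real \<Rightarrow> 'a" where
  "level_point c r z s = c + (r - s) *\<^sub>R sgn (z - c)"

lemma dist_level_point_centre:
  assumes "z \<noteq> c" "s \<le> r"
  shows "norm (level_point c r z s - c) = r - s"
  using assms by (simp add: level_point_def norm_sgn)

lemma dist_level_point_witness:
  assumes "z \<noteq> c" "r - norm (z - c) \<le> s"
  shows "norm (z - level_point c r z s) = s - (r - norm (z - c))"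
proof -
  define n where "n = sgn (z - c)"
  have "z - c = norm (z - c) *\<^sub>R n" using assms(1) by (simp add: n_def sgn_div_norm)
  then have "(z - c) - (r - s) *\<^sub>R n = norm (z - c) *\<^sub>R n - (r - s) *\<^sub>R n"
    by (rule arg_cong)
  moreover have "z - level_point c r z s = (z - c) - (r - s) *\<^sub>R n" by (simp add: level_point_def n_def)
  ultimately have "z - level_point c r z s = (norm (z - c) - (r - s)) *\<^sub>R sgn (z - c)"
    by (simp add: n_def scaleR_left_diff_distrib)
  then show ?thesis using assms by (simp add: norm_sgn)
qed

text \<open>The depth in ball \<open>j\<close> is 1-Lipschitz. At \<open>z i\<close> it is at most
  the depth in ball \<open>i\<close>, and moving inwards to level \<open>s\<close> raises it to at
  most \<open>s\<close>; the other point has depth exactly \<open>s'\<close> in ball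
  \<open>j\<close>.\<close>

lemma witnessed_level_gap:
  assumes W: "witnessed \<delta> \<rho> I c r z" and ij: "i \<in> I" "j \<in> I"
    and i: "r i - norm (z i - c i) \<le> s" "z i \<noteq> c i"
    and j: "s' \<le> r j" "z j \<noteq> c j"
  shows "s' - s \<le> dist (level_point (c i) (r i) (z i) s) (level_point (c j) (r j) (z j) s')"
proof -
  let ?X = "level_point (c i) (r i) (z i) s" and ?Y = "level_point (c j) (r j) (z j) s'"
  have "norm (z i - c i) - r i \<le> norm (z i - c j) - r j"
    using W ij by (simp add: witnessed_def)
  moreover have "norm (z i - ?X) = s - (r i - norm (z i - c i))"
    using dist_level_point_witness i by blast
  moreover have "norm (z i - c j) \<le> norm (z i - ?X) + norm (?X - c j)"
    using norm_triangle_ineq[of "z i - ?X" "?X - c j"] by simp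
  ultimately have "r j - s \<le> norm (?X - c j)" by linarith
  moreover have "norm (?Y - c j) = r j - s'"
    using dist_level_point_centre j by blast
  moreover have "norm (?X - c j) \<le> norm (?X - ?Y) + norm (?Y - c j)"
    using norm_triangle_ineq[of "?X - ?Y" "?Y - c j"] by simp
  ultimately show ?thesis by (simp add: dist_norm)
qed

text \<open>Bronshtein-Ivanov style contraction: the two rays are monotone, so their intermediate points
  control both the feet \<open>u\<close>, \<open>u'\<close> and the directions \<open>n\<close>, \<open>n'\<close>.\<close>

lemma ray_transfer:
  fixes u u' n n' :: "'a::euclidean_space"
  assumes "0 < \<sigma>" and n: "norm n = 1" "norm n' = 1"
    and nearest: "3 * \<sigma> \<le> norm (u + (3 * \<sigma>) *\<^sub>R n - u')" "3 * \<sigma> \<le> norm (u' + (3 * \<sigma>) *\<^sub>R n' - u)"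
    and \<mu>: "\<sigma> \<le> \<mu>" "\<mu> \<le> 2 * \<sigma>"
    and close: "norm (u + \<mu> *\<^sub>R n - (u' + \<mu> *\<^sub>R n')) \<le> \<eta>"
    and q: "0 \<le> q" "q \<le> 4 * \<sigma>"
  shows "(norm (u' + q *\<^sub>R n' - u))\<^sup>2 \<le> q\<^sup>2 + 69 * \<eta>\<^sup>2"
proof -
  define a where "a = u' - u"
  define b where "b = (u' + (3 * \<sigma>) *\<^sub>R n') - (u + (3 * \<sigma>) *\<^sub>R n)"
  have nn: "n \<bullet> n = 1" "n' \<bullet> n' = 1" using n by (simp_all add: dot_square_norm)
  have "(3 * \<sigma>)\<^sup>2 \<le> (norm ((3 * \<sigma>) *\<^sub>R n - a))\<^sup>2"
    using nearest(1) \<open>0 < \<sigma>\<close> by (intro power_mono) (simp_all add: a_def algebra_simps)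
  then have na: "6 * \<sigma> * (n \<bullet> a) \<le> a \<bullet> a"
    unfolding power2_norm_eq_inner
    by (simp add: inner_diff inner_commute nn power2_eq_square algebra_simps)
  have "(3 * \<sigma>)\<^sup>2 \<le> (norm ((3 * \<sigma>) *\<^sub>R n' + a))\<^sup>2"
    using nearest(2) \<open>0 < \<sigma>\<close> by (intro power_mono) (simp_all add: a_def algebra_simps)
  then have n'a: "- (a \<bullet> a) \<le> 6 * \<sigma> * (n' \<bullet> a)"
    unfolding power2_norm_eq_inner
    by (simp add: inner_add inner_commute nn power2_eq_square algebra_simps)
  \<comment> \<open>\<open>a\<close> joins the feet and \<open>b\<close> the far ends of the two
    segments. Their nonnegative product is the monotonicity: a convex combination of
    \<open>a\<close> and \<open>b\<close> with weights at least 1/3 cannot be short unless both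
    are.\<close>
  have ab: "0 \<le> a \<bullet> b"
  proof -
    have "b = a + (3 * \<sigma>) *\<^sub>R (n' - n)" by (simp add: a_def b_def algebra_simps)
    then have "a \<bullet> b = a \<bullet> a + 3 * \<sigma> * (n' \<bullet> a) - 3 * \<sigma> * (n \<bullet> a)"
      by (simp only: inner_add_right inner_diff_right inner_scaleR_right inner_commute right_diff_distrib add_diff_eq)
    with na n'a show ?thesis by linarith
  qed
  define \<alpha> where "\<alpha> = \<mu> / (3 * \<sigma>)"
  have \<alpha>: "1/3 \<le> \<alpha>" "\<alpha> \<le> 2/3" using \<mu> \<open>0 < \<sigma>\<close> by (simp_all add: \<alpha>_def field_simps)
  have "u' + \<mu> *\<^sub>R n' - (u + \<mu> *\<^sub>R n) = (1 - \<alpha>) *\<^sub>R a + \<alpha> *\<^sub>R b"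
    using \<open>0 < \<sigma>\<close> by (simp add: a_def b_def \<alpha>_def algebra_simps)
  then have "norm ((1 - \<alpha>) *\<^sub>R a + \<alpha> *\<^sub>R b) \<le> \<eta>" using close by (metis norm_minus_commute)
  then have "(norm ((1 - \<alpha>) *\<^sub>R a + \<alpha> *\<^sub>R b))\<^sup>2 \<le> \<eta>\<^sup>2" by (intro power_mono) simp_all
  then have "(1 - \<alpha>)\<^sup>2 * (a \<bullet> a) + \<alpha>\<^sup>2 * (b \<bullet> b) + 2 * \<alpha> * (1 - \<alpha>) * (a \<bullet> b) \<le> \<eta>\<^sup>2"
    unfolding power2_norm_eq_inner
    by (simp add: inner_add inner_commute power2_eq_square algebra_simps)
  moreover have "0 \<le> 2 * \<alpha> * (1 - \<alpha>) * (a \<bullet> b)" using \<alpha> ab by simp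
  moreover have "(1/3)\<^sup>2 * (a \<bullet> a) \<le> (1 - \<alpha>)\<^sup>2 * (a \<bullet> a)" "(1/3)\<^sup>2 * (b \<bullet> b) \<le> \<alpha>\<^sup>2 * (b \<bullet> b)"
    using \<alpha> by (intro mult_right_mono power_mono; simp)+
  ultimately have "a \<bullet> a + b \<bullet> b \<le> 9 * \<eta>\<^sup>2" by (simp add: power2_eq_square)
  then have aa: "a \<bullet> a \<le> 9 * \<eta>\<^sup>2" and bb: "b \<bullet> b \<le> 9 * \<eta>\<^sup>2" by (smt (verit) inner_ge_zero)+
  have \<eta>: "0 \<le> \<eta>" using close norm_ge_zero order_trans by blast
  have norm_a: "norm a \<le> 3 * \<eta>" and norm_b: "norm b \<le> 3 * \<eta>"
    using aa bb \<eta> by (simp_all add: norm_le_square power2_eq_square)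
  have "3 * \<sigma> * ((n' - n) \<bullet> a) \<le> norm (b - a) * norm a"
  proof -
    have "b - a = (3 * \<sigma>) *\<^sub>R (n' - n)" by (simp add: a_def b_def algebra_simps)
    then have "3 * \<sigma> * ((n' - n) \<bullet> a) = (b - a) \<bullet> a" by simp
    then show ?thesis using norm_cauchy_schwarz[of "b - a" a] by simp
  qed
  also have "\<dots> \<le> (6 * \<eta>) * (3 * \<eta>)"
    using norm_a norm_b norm_triangle_ineq4[of b a] by (intro mult_mono) (auto simp: \<eta>)
  finally have "6 * \<sigma> * (n' \<bullet> a) \<le> 6 * \<sigma> * (n \<bullet> a) + 36 * \<eta>\<^sup>2"
    by (simp add: inner_diff_left power2_eq_square algebra_simps)
  \<comment> \<open>\<open>(9 + 36) / 6 = 15/2\<close>. With \<open>q \<le> 4 * \<sigma>\<close>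
    this becomes \<open>30 * \<eta>\<^sup>2\<close>, and \<open>9 + 2 * 30 = 69\<close> is the
    constant of the conclusion.\<close>
  then have "\<sigma> * (n' \<bullet> a) \<le> 15/2 * \<eta>\<^sup>2" using na aa by linarith
  moreover have "q * (n' \<bullet> a) \<le> 30 * \<eta>\<^sup>2"
  proof (cases "n' \<bullet> a \<le> 0")
    case True
    then show ?thesis using q by (smt (verit) mult_nonneg_nonpos zero_le_power2)
  next
    case False
    then have "q * (n' \<bullet> a) \<le> 4 * \<sigma> * (n' \<bullet> a)" using q by (intro mult_right_mono) auto
    with \<open>\<sigma> * (n' \<bullet> a) \<le> 15/2 * \<eta>\<^sup>2\<close> show ?thesis by linarith
  qed
  moreover have "(norm (u' + q *\<^sub>R n' - u))\<^sup>2 = a \<bullet> a + 2 * q * (n' \<bullet> a) + q\<^sup>2"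
  proof -
    have "u' + q *\<^sub>R n' - u = a + q *\<^sub>R n'" by (simp add: a_def)
    then show ?thesis
      unfolding power2_norm_eq_inner
    by (simp add: inner_add inner_commute nn power2_eq_square algebra_simps)
  qed
  ultimately show ?thesis using aa by linarith
qed

text \<open>Take the rays from depth \<open>4 * \<sigma>\<close> out to depth
  \<open>\<sigma>\<close>. If they come closer than \<open>\<eta>\<close> in their middle third,
  \<open>ray_transfer\<close> puts the witness of each ball within
  \<open>4 * \<sigma> + \<delta> * \<rho>\<close> of the foot of the other ray, hence inside the
  other dilated ball. The statement \<open>covered\<close> is proved for both orders, which refutes
  both alternatives in \<open>witnessed\<close>.\<close>

lemma witnessed_same_level:
  assumes W: "witnessed \<delta> \<rho> I c r z" and ij: "i \<in> I" "j \<in> I" "i \<noteq> j"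
    and pos: "0 < \<delta>" "0 < \<sigma>" "5 * \<sigma> \<le> \<rho>"
    and shallow: "r i - norm (z i - c i) \<le> \<sigma>" "r j - norm (z j - c j) \<le> \<sigma>"
    and s: "2 * \<sigma> \<le> s" "s \<le> 3 * \<sigma>" and \<eta>: "0 \<le> \<eta>" "16 * \<eta>\<^sup>2 \<le> \<sigma> * \<delta> * \<rho>"
  shows "\<eta> \<le> dist (level_point (c i) (r i) (z i) s) (level_point (c j) (r j) (z j) s)"
proof (rule ccontr)
  assume "\<not> ?thesis"
  then have close: "norm (level_point (c i) (r i) (z i) s - level_point (c j) (r j) (z j) s) \<le> \<eta>"
    by (simp add: dist_norm)
  have covered: "norm (z l - c k) < (1 + \<delta>) * r k"
    if kl: "k \<in> I" "l \<in> I" and sh: "r k - norm (z k - c k) \<le> \<sigma>" "r l - norm (z l - c l) \<le> \<sigma>"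
      and cl: "norm (level_point (c k) (r k) (z k) s - level_point (c l) (r l) (z l) s) \<le> \<eta>" for k l
  proof -
    have rk: "\<rho> \<le> r k" "\<rho> \<le> r l" and inside: "norm (z l - c l) < r l"
      using W kl by (auto simp: witnessed_def)
    have ne: "z k \<noteq> c k" "z l \<noteq> c l" using rk sh pos by auto
    define n where "n = sgn (z k - c k)"
    define n' where "n' = sgn (z l - c l)"
    have n: "norm n = 1" "norm n' = 1" using ne by (simp_all add: n_def n'_def norm_sgn)
    define u where "u = level_point (c k) (r k) (z k) (4 * \<sigma>)"
    define u' where "u' = level_point (c l) (r l) (z l) (4 * \<sigma>)"
    have pt: "level_point (c k) (r k) (z k) t = u + (4 * \<sigma> - t) *\<^sub>R n" for t
      by (simp add: u_def level_point_def n_def algebra_simps)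
    have pt': "level_point (c l) (r l) (z l) t = u' + (4 * \<sigma> - t) *\<^sub>R n'" for t
      by (simp add: u'_def level_point_def n'_def algebra_simps)
    have "3 * \<sigma> \<le> dist (level_point (c k) (r k) (z k) \<sigma>) u'"
      using witnessed_level_gap[OF W kl sh(1) ne(1) _ ne(2), of "4 * \<sigma>"] rk pos by (simp add: u'_def)
    then have n1: "3 * \<sigma> \<le> norm (u + (3 * \<sigma>) *\<^sub>R n - u')" by (simp add: pt dist_norm)
    have "3 * \<sigma> \<le> dist (level_point (c l) (r l) (z l) \<sigma>) u"
      using witnessed_level_gap[OF W kl(2,1) sh(2) ne(2) _ ne(1), of "4 * \<sigma>"] rk pos by (simp add: u_def)
    then have n2: "3 * \<sigma> \<le> norm (u' + (3 * \<sigma>) *\<^sub>R n' - u)" by (simp add: pt' dist_norm)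
    define q where "q = 4 * \<sigma> - (r l - norm (z l - c l))"
    have q: "0 \<le> q" "q \<le> 4 * \<sigma>" using sh(2) inside pos by (auto simp: q_def)
    have z_eq: "z l = u' + q *\<^sub>R n'"
    proof -
      have "z l = c l + norm (z l - c l) *\<^sub>R n'" using ne by (simp add: n'_def sgn_div_norm)
      moreover have "norm (z l - c l) = (r l - 4 * \<sigma>) + q" by (simp add: q_def)
      ultimately have "z l = c l + ((r l - 4 * \<sigma>) + q) *\<^sub>R n'" by metis
      then show ?thesis by (simp add: u'_def level_point_def n'_def scaleR_add_left add.assoc)
    qed
    have "(norm (z l - u))\<^sup>2 \<le> q\<^sup>2 + 69 * \<eta>\<^sup>2"
      unfolding z_eq
      by (rule ray_transfer[where \<mu> = "4 * \<sigma> - s" and \<sigma> = \<sigma>]) (use n1 n2 n q s pos cl pt pt' in auto)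
    also have "\<dots> \<le> (4 * \<sigma>)\<^sup>2 + 69 * (\<sigma> * \<delta> * \<rho> / 16)"
      using q \<eta> by (intro add_mono power_mono) (auto simp: mult_ac)
    \<comment> \<open>The factor 16 in the choice of \<open>\<eta>\<close> is made for this step:
      \<open>69/16\<close> is below the coefficient 8 of the cross term.\<close>
    also have "\<dots> < (4 * \<sigma> + \<delta> * \<rho>)\<^sup>2"
    proof -
      have "0 < \<delta> * \<rho>" using pos by simp
      moreover from this have "0 < (\<delta> * \<rho>) * \<sigma>" "0 < (\<delta> * \<rho>)\<^sup>2" using pos by simp_all
      moreover have "(4 * \<sigma> + \<delta> * \<rho>)\<^sup>2 = (4 * \<sigma>)\<^sup>2 + 8 * ((\<delta> * \<rho>) * \<sigma>) + (\<delta> * \<rho>)\<^sup>2"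
        by (simp add: power2_eq_square algebra_simps)
      moreover have "69 * (\<sigma> * \<delta> * \<rho> / 16) = 69/16 * ((\<delta> * \<rho>) * \<sigma>)" by simp
      ultimately show ?thesis by linarith
    qed
    finally have "norm (z l - u) < 4 * \<sigma> + \<delta> * \<rho>"
      by (rule power2_less_imp_less) (use pos in auto)
    moreover have "norm (u - c k) = r k - 4 * \<sigma>"
      unfolding u_def by (rule dist_level_point_centre) (use ne rk pos in auto)
    moreover have "norm (z l - c k) \<le> norm (z l - u) + norm (u - c k)"
      using norm_triangle_ineq[of "z l - u" "u - c k"] by simp
    moreover have "\<delta> * \<rho> \<le> \<delta> * r k" using rk pos by simp
    ultimately show ?thesis by (simp add: algebra_simps)
  qed
  have "norm (z j - c i) < (1 + \<delta>) * r i" by (rule covered) (use ij shallow close in auto)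
  moreover have "norm (z i - c j) < (1 + \<delta>) * r j"
    by (rule covered) (use ij shallow close in \<open>auto simp: norm_minus_commute\<close>)
  moreover have "(1 + \<delta>) * r j \<le> norm (z i - c j) \<or> (1 + \<delta>) * r i \<le> norm (z j - c i)"
    using W ij unfolding witnessed_def by blast
  ultimately show False by linarith
qed

text \<open>Each index contributes \<open>M + 1 \<ge> t\<close> separated points along its tube. The
  packing bound is of order \<open>t ^ DIM('a)\<close>, so dividing by the number of points per tube
  saves one power of \<open>t\<close>; this is the source of the exponent
  \<open>DIM('a) - 1\<close>.\<close>

lemma card_le_of_tubes:
  fixes f :: "'i \<Rightarrow> nat \<Rightarrow> 'a::euclidean_space"
  assumes "finite I" "0 < \<eta>" "\<eta> \<le> L" "0 < t" "t \<le> real M + 1"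
    and bounded: "\<And>i m. i \<in> I \<Longrightarrow> m \<le> M \<Longrightarrow> norm (f i m) \<le> L"
    and separated: "\<And>i m j k. i \<in> I \<Longrightarrow> j \<in> I \<Longrightarrow> m \<le> M \<Longrightarrow> k \<le> M \<Longrightarrow> (i, m) \<noteq> (j, k) \<Longrightarrow>
        \<eta> \<le> dist (f i m) (f j k)"
    and K: "L / \<eta> \<le> K * t"
  shows "real (card I) \<le> (3 * K) ^ DIM('a) * t ^ (DIM('a) - 1)"
proof -
  have "real (card (I \<times> {..M})) \<le> (3 * L / \<eta>) ^ DIM('a)"
  proof (rule card_separated_le[where f = "\<lambda>(i, m). f i m"])
    fix p q assume "p \<in> I \<times> {..M}" "q \<in> I \<times> {..M}" "p \<noteq> q"
    then show "\<eta> \<le> dist (case p of (i, m) \<Rightarrow> f i m) (case q of (i, m) \<Rightarrow> f i m)"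
      using separated[of "fst p" "fst q" "snd p" "snd q"] by (auto simp: case_prod_beta prod_eq_iff)
  qed (use assms in auto)
  also have "\<dots> \<le> (3 * K * t) ^ DIM('a)"
    using K assms by (intro power_mono) auto
  also have "\<dots> = ((3 * K) ^ DIM('a) * t ^ (DIM('a) - 1)) * t"
    using power_minus_mult[of "DIM('a)" t] by (simp add: power_mult_distrib)
  finally have "real (card I) * (real M + 1) \<le> ((3 * K) ^ DIM('a) * t ^ (DIM('a) - 1)) * t"
    by (simp add: card_cartesian_product algebra_simps)
  moreover have "real (card I) * t \<le> real (card I) * (real M + 1)"
    using assms by (intro mult_left_mono) auto
  ultimately have "real (card I) * t \<le> ((3 * K) ^ DIM('a) * t ^ (DIM('a) - 1)) * t" by linarith
  then show ?thesis using \<open>0 < t\<close> by (rule mult_right_le_imp_le)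
qed

lemma norm_level_point_le:
  assumes "z \<noteq> c" "r - norm (z - c) \<le> s" "norm (z - c) \<le> r"
  shows "norm (level_point c r z s) \<le> norm z + s"
proof -
  have "norm (level_point c r z s) \<le> norm z + norm (z - level_point c r z s)"
    using norm_triangle_ineq4[of z "z - level_point c r z s"] by simp
  then show ?thesis using dist_level_point_witness[OF assms(1,2)] assms(3) by linarith
qed

text \<open>Points on equal levels are separated by the tube argument, points on different levels by
  the difference of their depths, which is at least \<open>\<eta>\<close>.\<close>

lemma witnessed_grid_separated:
  assumes W: "witnessed \<delta> \<rho> I c r z" and ij: "i \<in> I" "j \<in> I" "(i, m) \<noteq> (j, k)"
    and pos: "0 < \<delta>" "0 < \<sigma>" "5 * \<sigma> \<le> \<rho>"
    and shallow: "\<And>i. i \<in> I \<Longrightarrow> r i - norm (z i - c i) \<le> \<sigma>"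
    and \<eta>: "0 \<le> \<eta>" "16 * \<eta>\<^sup>2 \<le> \<sigma> * \<delta> * \<rho>" and mk: "real m * \<eta> \<le> \<sigma>" "real k * \<eta> \<le> \<sigma>"
  shows "\<eta> \<le> dist (level_point (c i) (r i) (z i) (2 * \<sigma> + real m * \<eta>))
                   (level_point (c j) (r j) (z j) (2 * \<sigma> + real k * \<eta>))"
proof (cases "m = k")
  case True
  show ?thesis
    unfolding True
    by (rule witnessed_same_level[OF W ij(1,2) _ pos shallow shallow _ _ \<eta>])
       (use ij True mk \<eta> in auto)
next
  case False
  have far: "\<eta> \<le> dist (level_point (c i) (r i) (z i) (2 * \<sigma> + real m * \<eta>))
                   (level_point (c j) (r j) (z j) (2 * \<sigma> + real k * \<eta>))"
    if "i \<in> I" "j \<in> I" "m < k" "real k * \<eta> \<le> \<sigma>" for i j m k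
  proof -
    have rho: "\<rho> \<le> r i" "\<rho> \<le> r j" using W that by (auto simp: witnessed_def)
    then have ne: "z i \<noteq> c i" "z j \<noteq> c j" using shallow that pos by fastforce+
    have sh: "r i - norm (z i - c i) \<le> 2 * \<sigma> + real m * \<eta>"
      using shallow[OF that(1)] \<open>0 \<le> \<eta>\<close> pos mult_nonneg_nonneg[of "real m" \<eta>] by linarith
    have "(2 * \<sigma> + real k * \<eta>) - (2 * \<sigma> + real m * \<eta>) \<le>
        dist (level_point (c i) (r i) (z i) (2 * \<sigma> + real m * \<eta>))
             (level_point (c j) (r j) (z j) (2 * \<sigma> + real k * \<eta>))"
      by (rule witnessed_level_gap[OF W that(1,2) sh ne(1) _ ne(2)]) (use that pos rho in linarith)
    moreover have "\<eta> * 1 \<le> \<eta> * (real k - real m)" using that \<eta> by (intro mult_left_mono) auto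
    ultimately show ?thesis by (simp add: algebra_simps)
  qed
  show ?thesis
  proof (cases "m < k")
    case True
    then show ?thesis using far ij mk by blast
  next
    case not_less: False
    with False have "k < m" by simp
    then show ?thesis using far[OF ij(2,1) _ mk(1)] by (simp add: dist_commute)
  qed
qed

text \<open>Tubes of length \<open>\<sigma>\<close> with spacing
  \<open>\<eta> = sqrt (\<sigma> * \<delta> * \<rho>) / 4\<close> are packed into a ball of radius
  \<open>(A + 3) * \<sigma>\<close>. The bound depends on the ratio
  \<open>\<sigma> / \<eta>\<close>, so a small region around the origin gains over the full scale
  \<open>\<rho>\<close>; the condition \<open>\<delta> * \<rho> \<le> 16 * \<sigma>\<close> says
  \<open>\<eta> \<le> \<sigma>\<close>.\<close>

lemma card_shallow_le:
  fixes c :: "'i \<Rightarrow> 'a::euclidean_space"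
  assumes W: "witnessed \<delta> \<rho> I c r z"
    and pos: "0 < \<delta>" "0 < \<sigma>" "5 * \<sigma> \<le> \<rho>" "\<delta> * \<rho> \<le> 16 * \<sigma>" "0 \<le> A"
    and near: "\<And>i. i \<in> I \<Longrightarrow> norm (z i) \<le> A * \<sigma>"
    and shallow: "\<And>i. i \<in> I \<Longrightarrow> r i - norm (z i - c i) \<le> \<sigma>"
  shows "real (card I) \<le> (3 * (A + 3)) ^ DIM('a) * sqrt (16 * \<sigma> / (\<delta> * \<rho>)) ^ (DIM('a) - 1)"
proof -
  have \<rho>: "0 < \<rho>" using pos by linarith
  define \<eta> where "\<eta> = sqrt (\<sigma> * \<delta> * \<rho>) / 4"
  have \<eta>_pos: "0 < \<eta>" using pos \<rho> by (simp add: \<eta>_def)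
  have \<eta>_sq: "16 * \<eta>\<^sup>2 = \<sigma> * \<delta> * \<rho>" using pos \<rho> by (simp add: \<eta>_def power_divide)
  have \<eta>_le: "\<eta> \<le> \<sigma>"
  proof -
    have "\<sigma> * (\<delta> * \<rho>) \<le> \<sigma> * (16 * \<sigma>)" using pos by (intro mult_left_mono) auto
    then have "\<eta>\<^sup>2 \<le> \<sigma>\<^sup>2" using \<eta>_sq by (simp add: power2_eq_square)
    then show ?thesis by (rule power2_le_imp_le) (use pos in auto)
  qed
  define M where "M = nat \<lfloor>\<sigma> / \<eta>\<rfloor>"
  have M: "\<sigma> / \<eta> \<le> real M + 1" "real M * \<eta> \<le> \<sigma>"
  proof -
    have "0 \<le> \<sigma> / \<eta>" using pos \<eta>_pos by simp
    then have "real M = of_int \<lfloor>\<sigma> / \<eta>\<rfloor>" by (simp add: M_def)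
    then have "real M \<le> \<sigma> / \<eta>" "\<sigma> / \<eta> \<le> real M + 1" by linarith+
    then show "\<sigma> / \<eta> \<le> real M + 1" "real M * \<eta> \<le> \<sigma>"
      using \<eta>_pos by (simp_all add: pos_le_divide_eq)
  qed
  have mM: "real m * \<eta> \<le> \<sigma>" if "m \<le> M" for m
  proof -
    have "real m * \<eta> \<le> real M * \<eta>" using that \<eta>_pos by (intro mult_right_mono) auto
    with M(2) show ?thesis by linarith
  qed
  have "sqrt (16 * \<sigma> / (\<delta> * \<rho>)) = \<sigma> / \<eta>"
  proof (rule real_sqrt_unique)
    show "(\<sigma> / \<eta>)\<^sup>2 = 16 * \<sigma> / (\<delta> * \<rho>)"
    proof -
      have "\<eta>\<^sup>2 = \<sigma> * \<delta> * \<rho> / 16" using \<eta>_sq by simp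
      then have "(\<sigma> / \<eta>)\<^sup>2 = \<sigma>\<^sup>2 / (\<sigma> * \<delta> * \<rho> / 16)" by (simp only: power_divide)
      then show ?thesis using pos \<rho> by (simp add: power2_eq_square)
    qed
    show "0 \<le> \<sigma> / \<eta>" using pos \<eta>_pos by simp
  qed
  moreover have "real (card I) \<le> (3 * (A + 3)) ^ DIM('a) * (\<sigma> / \<eta>) ^ (DIM('a) - 1)"
  proof (rule card_le_of_tubes[where M = M and \<eta> = \<eta> and L = "(A + 3) * \<sigma>" and
        f = "\<lambda>i m. level_point (c i) (r i) (z i) (2 * \<sigma> + real m * \<eta>)"])
    fix i m assume im: "i \<in> I" "m \<le> M"
    have inside: "norm (z i - c i) < r i" "\<rho> \<le> r i" using W im by (auto simp: witnessed_def)
    then have "z i \<noteq> c i" using shallow[OF im(1)] pos by auto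
    moreover have "r i - norm (z i - c i) \<le> 2 * \<sigma> + real m * \<eta>"
      using shallow[OF im(1)] \<eta>_pos pos mult_nonneg_nonneg[of "real m" \<eta>] by linarith
    ultimately have "norm (level_point (c i) (r i) (z i) (2 * \<sigma> + real m * \<eta>))
        \<le> norm (z i) + (2 * \<sigma> + real m * \<eta>)"
      using inside by (intro norm_level_point_le) auto
    also have "\<dots> \<le> (A + 3) * \<sigma>" using near[OF im(1)] mM[OF im(2)] by (simp add: algebra_simps)
    finally show "norm (level_point (c i) (r i) (z i) (2 * \<sigma> + real m * \<eta>)) \<le> (A + 3) * \<sigma>" .
  next
    fix i m j k assume "i \<in> I" "j \<in> I" "m \<le> M" "k \<le> M" "(i, m) \<noteq> (j, k)"
    then show "\<eta> \<le> dist (level_point (c i) (r i) (z i) (2 * \<sigma> + real m * \<eta>))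
          (level_point (c j) (r j) (z j) (2 * \<sigma> + real k * \<eta>))"
      using \<eta>_pos \<eta>_sq mM pos by (intro witnessed_grid_separated[OF W _ _ _ _ _ _ shallow]) auto
  next
    have "1 * \<sigma> \<le> (A + 3) * \<sigma>" using pos by (intro mult_right_mono) auto
    then show "\<eta> \<le> (A + 3) * \<sigma>" using \<eta>_le by simp
  qed (use W M \<eta>_pos pos in \<open>auto simp: witnessed_def\<close>)
  ultimately show ?thesis by simp
qed

text \<open>The ball of radius \<open>\<sigma>\<close> about a deep witness lies in the undilated
  ball, so two closer witnesses would each be covered by the other ball. The witnesses themselves
  are thus \<open>\<sigma>\<close>-separated, and no power of \<open>\<delta>\<close>
  appears.\<close>

lemma card_deep_le:
  fixes c :: "'i \<Rightarrow> 'a::euclidean_space"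
  assumes W: "witnessed \<delta> \<rho> I c r z" and pos: "0 \<le> \<delta>" "0 < \<sigma>" "1 \<le> A" "0 \<le> \<rho>"
    and near: "\<And>i. i \<in> I \<Longrightarrow> norm (z i) \<le> A * \<sigma>"
    and deep: "\<And>i. i \<in> I \<Longrightarrow> \<sigma> < r i - norm (z i - c i)"
  shows "real (card I) \<le> (3 * A) ^ DIM('a)"
proof -
  have "real (card I) \<le> (3 * (A * \<sigma>) / \<sigma>) ^ DIM('a)"
  proof (rule card_separated_le[where f = z])
    fix i j assume ij: "i \<in> I" "j \<in> I" "i \<noteq> j"
    have covered: "norm (z l - c k) < (1 + \<delta>) * r k" if "k \<in> I" "l \<in> I" "dist (z k) (z l) < \<sigma>" for k l
    proof -
      have "norm (z l - c k) \<le> norm (z l - z k) + norm (z k - c k)"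
        using norm_triangle_ineq[of "z l - z k" "z k - c k"] by simp
      also have "\<dots> < r k" using that deep[of k] by (simp add: dist_norm norm_minus_commute)
      also have "\<dots> \<le> (1 + \<delta>) * r k"
      proof -
        have "0 \<le> \<delta> * r k" using W that pos by (auto simp: witnessed_def)
        then show ?thesis by (simp add: algebra_simps)
      qed
      finally show ?thesis .
    qed
    show "\<sigma> \<le> dist (z i) (z j)"
    proof (rule ccontr)
      assume "\<not> ?thesis"
      then have "norm (z j - c i) < (1 + \<delta>) * r i" "norm (z i - c j) < (1 + \<delta>) * r j"
        using covered ij by (auto simp: dist_commute)
      moreover have "(1 + \<delta>) * r j \<le> norm (z i - c j) \<or> (1 + \<delta>) * r i \<le> norm (z j - c i)"
        using W ij unfolding witnessed_def by blast
      ultimately show False by linarith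
    qed
  qed (use W pos near in \<open>auto simp: witnessed_def\<close>)
  then show ?thesis using pos by simp
qed

subsection \<open>Balls of different scales\<close>

text \<open>\<open>p\<close>, \<open>p'\<close> stand for nearest points of a convex set,
  \<open>w\<close>, \<open>w'\<close> for the outward unit normals there, and \<open>D\<close>,
  \<open>D'\<close> for the heights above it. The supporting hyperplanes control the difference of
  the pushed heights, and monotonicity of the normals controls feet and normals separately;
  \<open>1004 = 2 + 2 + 1000\<close>, where 1000 undoes the slope.\<close>

lemma norm_diff_le_of_pushed:
  fixes p p' w w' :: "'a::euclidean_space"
  assumes w: "norm w = 1" "norm w' = 1"
    and normal: "w \<bullet> (p' - p) \<le> 0" "w' \<bullet> (p - p') \<le> 0"
    and D: "0 \<le> D" "D \<le> 40" "0 \<le> D'" "D' \<le> 40"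
  shows "norm (p + D *\<^sub>R w - (p' + D' *\<^sub>R w')) \<le>
    1004 * norm (p + (40 + D / 1000) *\<^sub>R w - (p' + (40 + D' / 1000) *\<^sub>R w'))"
proof -
  define A where "A = 40 + D / 1000"
  define A' where "A' = 40 + D' / 1000"
  define v where "v = p + A *\<^sub>R w - (p' + A' *\<^sub>R w')"
  define E where "E = norm v"
  have ww: "w \<bullet> w = 1" "w' \<bullet> w' = 1" using w by (simp_all add: dot_square_norm)
  have ww': "w \<bullet> w' \<le> 1" using norm_cauchy_schwarz[of w w'] w by simp
  have A: "0 \<le> A" "0 \<le> A'" "D \<le> A" using D by (simp_all add: A_def A'_def)
  have "A - A' \<le> E"
  proof -
    have "v \<bullet> w = - (w \<bullet> (p' - p)) + A - A' * (w \<bullet> w')"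
      by (simp add: v_def inner_add inner_diff inner_commute ww algebra_simps)
    moreover have "A' * (w \<bullet> w') \<le> A' * 1" using ww' A by (intro mult_left_mono)
    ultimately have "A - A' \<le> v \<bullet> w" using normal(1) by linarith
    then show ?thesis using norm_cauchy_schwarz[of v w] w by (simp add: E_def)
  qed
  moreover have "A' - A \<le> E"
  proof -
    have "- (v \<bullet> w') = - (w' \<bullet> (p - p')) + A' - A * (w \<bullet> w')"
      by (simp add: v_def inner_add inner_diff inner_commute ww algebra_simps)
    moreover have "A * (w \<bullet> w') \<le> A * 1" using ww' A by (intro mult_left_mono)
    ultimately have "A' - A \<le> - (v \<bullet> w')" using normal(2) by linarith
    then show ?thesis using norm_cauchy_schwarz[of "- v" w'] w by (simp add: E_def)
  qed
  ultimately have AA: "\<bar>A - A'\<bar> \<le> E" by linarith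
  define y where "y = (p - p') + A *\<^sub>R (w - w')"
  have "y = v + (A' - A) *\<^sub>R w'" by (simp add: y_def v_def algebra_simps)
  then have "norm y \<le> E + \<bar>A' - A\<bar> * norm w'" using norm_triangle_ineq[of v "(A' - A) *\<^sub>R w'"] by (simp add: E_def)
  then have y: "norm y \<le> 2 * E" using AA w by simp
  \<comment> \<open>Monotonicity of the normal map: the cross term in the square of
    \<open>norm y\<close> is nonnegative, so each of the two parts of \<open>y\<close> is bounded by
    \<open>norm y\<close>.\<close>
  have "0 \<le> (p - p') \<bullet> (w - w')"
    using normal by (simp add: inner_diff inner_commute algebra_simps)
  then have "0 \<le> 2 * A * ((p - p') \<bullet> (w - w'))" using A by simp
  moreover have "(norm y)\<^sup>2 = (norm (p - p'))\<^sup>2 + 2 * A * ((p - p') \<bullet> (w - w')) + (A * norm (w - w'))\<^sup>2"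
  proof -
    have "(norm y)\<^sup>2 = (norm (p - p'))\<^sup>2 + 2 * ((p - p') \<bullet> (A *\<^sub>R (w - w'))) + (norm (A *\<^sub>R (w - w')))\<^sup>2"
      unfolding y_def power2_norm_eq_inner by (simp add: inner_add_left inner_add_right inner_commute)
    then show ?thesis using A by simp
  qed
  moreover have "(norm y)\<^sup>2 \<le> (2 * E)\<^sup>2" using y by (intro power_mono) auto
  ultimately have "(norm (p - p'))\<^sup>2 \<le> (2 * E)\<^sup>2" "(A * norm (w - w'))\<^sup>2 \<le> (2 * E)\<^sup>2"
    using zero_le_power2[of "norm (p - p')"] zero_le_power2[of "A * norm (w - w')"] by linarith+
  moreover have "0 \<le> 2 * E" by (simp add: E_def)
  ultimately have p: "norm (p - p') \<le> 2 * E" and Aw: "A * norm (w - w') \<le> 2 * E"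
    by (blast intro: power2_le_imp_le)+
  have "D * norm (w - w') \<le> A * norm (w - w')" using A by (intro mult_right_mono) auto
  with Aw have Dw: "D * norm (w - w') \<le> 2 * E" by linarith
  have DD: "\<bar>D - D'\<bar> \<le> 1000 * E" using AA by (simp add: A_def A'_def)
  have "p + D *\<^sub>R w - (p' + D' *\<^sub>R w') = (p - p') + D *\<^sub>R (w - w') + (D - D') *\<^sub>R w'"
    by (simp add: algebra_simps)
  also have "norm \<dots> \<le> norm (p - p') + norm (D *\<^sub>R (w - w')) + norm ((D - D') *\<^sub>R w')"
    by (intro order_trans[OF norm_triangle_ineq] add_mono norm_triangle_ineq order_refl)
  also have "\<dots> \<le> 1004 * E" using p Dw DD D w by simp
  finally show ?thesis by (simp add: E_def v_def A_def A'_def)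
qed

lemma sgn_inner_nonpos: "u \<bullet> v \<le> 0 \<Longrightarrow> sgn u \<bullet> v \<le> 0" for u v :: "'a::euclidean_space"
  unfolding sgn_div_norm inner_scaleR_left by (intro mult_nonneg_nonpos) auto

text \<open>The constant 40 exceeds every distance to \<open>H\<close> that occurs below, so that points belonging to
  different scales end up on different sides of the level 40 of the growing sets \<open>H\<close>. The slope
  1/1000 keeps the map injective with a Lipschitz inverse, at a cost smaller than the gap.\<close>

definition push_out :: "'a::euclidean_space set \<Rightarrow> 'a \<Rightarrow> 'a" where
  "push_out H x = closest_point H x +
     (40 + dist x (closest_point H x) / 1000) *\<^sub>R sgn (x - closest_point H x)"

lemma norm_diff_le_push_out:
  assumes H: "convex H" "closed H" and x: "x \<notin> H" "dist x (closest_point H x) \<le> 40"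
    and y: "y \<notin> H" "dist y (closest_point H y) \<le> 40" and "H \<noteq> {}"
  shows "norm (x - y) \<le> 1004 * norm (push_out H x - push_out H y)"
proof -
  define p where "p = closest_point H x"
  define p' where "p' = closest_point H y"
  have mem: "p \<in> H" "p' \<in> H" using H \<open>H \<noteq> {}\<close> by (simp_all add: p_def p'_def closest_point_in_set)
  have dot: "(x - p) \<bullet> (p' - p) \<le> 0" "(y - p') \<bullet> (p - p') \<le> 0"
    using closest_point_dot[OF H] mem unfolding p_def p'_def by blast+
  have ne: "x \<noteq> p" "y \<noteq> p'" using x y mem by auto
  have "norm ((p + dist x p *\<^sub>R sgn (x - p)) - (p' + dist y p' *\<^sub>R sgn (y - p'))) \<le>
    1004 * norm (p + (40 + dist x p / 1000) *\<^sub>R sgn (x - p) - (p' + (40 + dist y p' / 1000) *\<^sub>R sgn (y - p')))"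
  proof (rule norm_diff_le_of_pushed)
    show "sgn (x - p) \<bullet> (p' - p) \<le> 0" "sgn (y - p') \<bullet> (p - p') \<le> 0"
      using dot by (simp_all only: sgn_inner_nonpos)
  qed (use ne x y in \<open>simp_all add: norm_sgn p_def[symmetric] p'_def[symmetric]\<close>)
  moreover have "p + dist x p *\<^sub>R sgn (x - p) = x" "p' + dist y p' *\<^sub>R sgn (y - p') = y"
    using ne by (simp_all add: sgn_div_norm dist_norm)
  ultimately show ?thesis by (simp add: push_out_def p_def[symmetric] p'_def[symmetric])
qed

text \<open>Measured along the outward normal at the nearest point, \<open>h\<close> is at most at
  height 0, so \<open>y\<close> is at most at height \<open>40 - e\<close>, while the pushed point
  is at height at least 40.\<close>

lemma push_out_separated:
  assumes H: "convex H" "closed H" and x: "x \<notin> H" and h: "h \<in> H" and y: "norm (y - h) \<le> 40 - e"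
  shows "e \<le> norm (push_out H x - y)"
proof -
  define p where "p = closest_point H x"
  define w where "w = sgn (x - p)"
  define A where "A = 40 + dist x p / 1000"
  have p: "p \<in> H" using H h by (auto simp: p_def intro: closest_point_in_set)
  have dot: "(x - p) \<bullet> (h - p) \<le> 0" using closest_point_dot[OF H h] unfolding p_def .
  have ne: "x \<noteq> p" using x p by auto
  have wh: "w \<bullet> (h - p) \<le> 0" using dot unfolding w_def by (rule sgn_inner_nonpos)
  have w: "norm w = 1" using ne by (simp add: w_def norm_sgn)
  then have ww: "w \<bullet> w = 1" by (simp add: dot_square_norm)
  have "(push_out H x - y) \<bullet> w = A - w \<bullet> (h - p) - (y - h) \<bullet> w"
    by (simp add: push_out_def p_def[symmetric] w_def[symmetric] A_def[symmetric]
        inner_add inner_diff inner_commute ww algebra_simps)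
  moreover have "(y - h) \<bullet> w \<le> 40 - e" using norm_cauchy_schwarz[of "y - h" w] w y by simp
  moreover have "40 \<le> A" by (simp add: A_def)
  ultimately have "e \<le> (push_out H x - y) \<bullet> w" using wh by linarith
  then show ?thesis using norm_cauchy_schwarz[of "push_out H x - y" w] w by simp
qed

text \<open>In units of \<open>\<rho> / 8\<close> the level point is
  \<open>a *\<^sub>R sgn c + b *\<^sub>R z\<close> with \<open>a\<close> between 3/4 and 4. The
  functional \<open>z\<close> is almost nonpositive on \<open>H\<close> but definitely positive on
  \<open>sgn c\<close>, so the distance of \<open>x\<close> to \<open>H\<close> exceeds
  \<open>b * norm z\<close> by a definite amount. Hence pushing \<open>x\<close> to height about 40
  leaves it strictly closer than 40 to the point \<open>a *\<^sub>R sgn c\<close>.\<close>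

lemma push_out_level_point:
  fixes c z :: "'a::euclidean_space"
  assumes \<rho>: "\<rho> \<le> r" "r < 2 * \<rho>" and c: "norm c < r" "3 * r \<le> 4 * norm c"
    and z: "z \<noteq> 0" "norm (z - c) < r" "r - norm (z - c) \<le> \<rho> / 8" "(norm z)\<^sup>2 \<le> 4 * (z \<bullet> c)"
    and H: "convex H" "closed H" "0 \<in> H" "\<And>h. h \<in> H \<Longrightarrow> z \<bullet> h \<le> (norm z)\<^sup>2 / (24 * \<rho>)"
    and l: "2 \<le> l" "l \<le> 3"
  defines "x \<equiv> (8 / \<rho>) *\<^sub>R level_point c r z (l * \<rho> / 8)"
  shows "x \<notin> H" "dist x (closest_point H x) \<le> 40"
    "\<exists>h \<in> convex hull {0, 4 *\<^sub>R sgn c}. norm (push_out H x - h) \<le> 40 - norm z / (64 * \<rho>)"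
proof -
  define N where "N = norm (z - c)"
  define \<mu> where "\<mu> = (r - l * \<rho> / 8) / N"
  define a where "a = 8 / \<rho> * (1 - \<mu>) * norm c"
  define b where "b = 8 / \<rho> * \<mu>"
  define t where "t = norm z"
  have \<rho>0: "0 < \<rho>" using \<rho> by linarith
  have lb: "2 * \<rho> \<le> l * \<rho>" "l * \<rho> \<le> 3 * \<rho>" using l \<rho>0 by (intro mult_right_mono; simp)+
  have N: "7 * r \<le> 8 * N" "N < r" "0 < N" using z \<rho> \<rho>0 by (auto simp: N_def)
  have "0 \<le> r - l * \<rho> / 8" "r - l * \<rho> / 8 \<le> N" using lb \<rho> \<rho>0 z(3) unfolding N_def by linarith+
  then have \<mu>: "0 \<le> \<mu>" "\<mu> \<le> 1" using N by (simp_all add: \<mu>_def)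
  have c0: "c \<noteq> 0" "0 < norm c" using c \<rho> \<rho>0 by auto
  have one_\<mu>: "1 - \<mu> = (N - r + l * \<rho> / 8) / N" using N by (simp add: \<mu>_def field_simps)
  have a_lower: "3/4 \<le> a"
  proof -
    have "\<rho> / 8 \<le> N - r + l * \<rho> / 8" using z(3) lb by (simp add: N_def)
    then have "\<rho> / 8 / N \<le> 1 - \<mu>" unfolding one_\<mu> using N by (intro divide_right_mono) auto
    then have "8 / \<rho> * (\<rho> / 8 / N) * norm c \<le> a"
      unfolding a_def using \<rho>0 by (intro mult_right_mono mult_left_mono) auto
    moreover have "8 / \<rho> * (\<rho> / 8 / N) * norm c = norm c / N" using \<rho>0 by simp
    moreover have "3/4 \<le> norm c / N" using c N by (simp add: pos_le_divide_eq)
    ultimately show ?thesis by linarith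
  qed
  have a_upper: "a \<le> 4"
  proof -
    have "N - r + l * \<rho> / 8 \<le> 3 * \<rho> / 8" using N lb by simp
    then have "1 - \<mu> \<le> 3 * \<rho> / 8 / N" unfolding one_\<mu> using N by (intro divide_right_mono) auto
    then have "a \<le> 8 / \<rho> * (3 * \<rho> / 8 / N) * norm c"
      unfolding a_def using \<rho>0 by (intro mult_right_mono mult_left_mono) auto
    moreover have "8 / \<rho> * (3 * \<rho> / 8 / N) * norm c = 3 * norm c / N" using \<rho>0 by simp
    moreover have "3 * norm c / N \<le> 4" using c N by (simp add: pos_divide_le_eq)
    ultimately show ?thesis by linarith
  qed
  have b: "0 \<le> b" "b \<le> 8 / \<rho>" using \<mu> \<rho>0 by (simp_all add: b_def divide_right_mono)
  have t: "0 < t" "t \<le> 4 * \<rho>"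
    using z(1,2) c(1) \<rho> norm_triangle_ineq[of "z - c" c] by (auto simp: t_def)
  have x: "x = a *\<^sub>R sgn c + b *\<^sub>R z"
  proof -
    have "level_point c r z (l * \<rho> / 8) = (1 - \<mu>) *\<^sub>R c + \<mu> *\<^sub>R z"
    proof -
      have "N *\<^sub>R sgn (z - c) = z - c" using N by (simp add: N_def sgn_div_norm)
      moreover have "r - l * \<rho> / 8 = \<mu> * N" using N by (simp add: \<mu>_def)
      ultimately have "level_point c r z (l * \<rho> / 8) = c + \<mu> *\<^sub>R (z - c)"
        by (simp only: level_point_def scaleR_scaleR[symmetric])
      then show ?thesis by (simp add: algebra_simps)
    qed
    moreover have "norm c *\<^sub>R sgn c = c" using c0 by (simp add: sgn_div_norm)
    then have "(1 - \<mu>) *\<^sub>R c = ((1 - \<mu>) * norm c) *\<^sub>R sgn c" by (metis scaleR_scaleR)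
    ultimately show ?thesis by (simp add: x_def a_def b_def scaleR_add_right mult.assoc)
  qed
  define p where "p = closest_point H x"
  have p: "p \<in> H" using H by (auto simp: p_def intro: closest_point_in_set)
  define D where "D = dist x p"
  \<comment> \<open>\<open>g\<close> is the excess of the distance \<open>D\<close> over
    \<open>b * t\<close>. It comes from \<open>3/4 * 1/8 - 1/24 = 5/96 \<ge> 1/32\<close>; half of
    it remains after the slope 1/1000 has been paid for, which gives the 64 in the claim.\<close>
  define g where "g = t / (32 * \<rho>)"
  have g: "0 < g" using t \<rho>0 by (simp add: g_def)
  have D_lower: "b * t + g \<le> D"
  proof -
    have "t\<^sup>2 / (8 * \<rho>) \<le> z \<bullet> sgn c"
    proof -
      have "t\<^sup>2 / (8 * \<rho>) \<le> t\<^sup>2 / (4 * norm c)"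
        using c c0 \<rho> \<rho>0 by (intro divide_left_mono) auto
      also have "\<dots> \<le> (z \<bullet> c) / norm c" using z(4) c0 by (simp add: t_def field_simps)
      also have "\<dots> = z \<bullet> sgn c" by (simp add: sgn_div_norm divide_inverse mult.commute)
      finally show ?thesis .
    qed
    then have "3/4 * (t\<^sup>2 / (8 * \<rho>)) \<le> a * (z \<bullet> sgn c)"
      using a_lower \<rho>0 by (intro mult_mono) auto
    moreover have "z \<bullet> x = a * (z \<bullet> sgn c) + b * t\<^sup>2"
      by (simp add: x inner_add_right t_def power2_norm_eq_inner)
    moreover have "z \<bullet> p \<le> t\<^sup>2 / (24 * \<rho>)" using H(4)[OF p] by (simp add: t_def)
    ultimately have "3/4 * (t\<^sup>2 / (8 * \<rho>)) + b * t\<^sup>2 - t\<^sup>2 / (24 * \<rho>) \<le> z \<bullet> (x - p)"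
      by (simp add: inner_diff_right)
    moreover have "z \<bullet> (x - p) \<le> t * D"
      using norm_cauchy_schwarz[of z "x - p"] by (simp add: t_def D_def dist_norm)
    moreover have "t * (b * t + g) \<le> 3/4 * (t\<^sup>2 / (8 * \<rho>)) + b * t\<^sup>2 - t\<^sup>2 / (24 * \<rho>)"
    proof -
      define q where "q = t\<^sup>2 / \<rho>"
      have "0 \<le> q" using \<rho>0 by (simp add: q_def)
      moreover have "t * (b * t + g) = b * t\<^sup>2 + q / 32" by (simp add: g_def q_def power2_eq_square algebra_simps)
      moreover have "t\<^sup>2 / (8 * \<rho>) = q / 8" "t\<^sup>2 / (24 * \<rho>) = q / 24" by (simp_all add: q_def)
      ultimately show ?thesis by linarith
    qed
    ultimately have "t * (b * t + g) \<le> t * D" by linarith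
    then show ?thesis using t by simp
  qed
  have bt: "b * t \<le> 256 * g"
  proof -
    have "b * t \<le> 8 / \<rho> * t" using b t by (intro mult_right_mono) auto
    then show ?thesis by (simp add: g_def)
  qed
  have bt0: "0 \<le> b * t" using b t by simp
  have "8 / \<rho> * t \<le> 32" using t \<rho>0 by (simp add: field_simps)
  then have bt32: "b * t \<le> 32" using bt by (simp add: g_def)
  have D0: "0 < D" using D_lower g bt0 by linarith
  have "x \<noteq> p" using D0 by (auto simp: D_def)
  then show "x \<notin> H" using closest_point_self[of x H] by (auto simp: p_def)
  have "D \<le> norm x" using closest_point_le[OF H(2) H(3), of x] by (simp add: D_def p_def)
  also have "\<dots> \<le> a + b * t"
    using norm_triangle_ineq[of "a *\<^sub>R sgn c" "b *\<^sub>R z"] a_lower b c0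
    by (simp add: x norm_sgn t_def)
  finally have D40: "D \<le> 40" using a_upper bt32 by linarith
  then show "dist x (closest_point H x) \<le> 40" by (simp add: D_def p_def)
  show "\<exists>h \<in> convex hull {0, 4 *\<^sub>R sgn c}. norm (push_out H x - h) \<le> 40 - norm z / (64 * \<rho>)"
  proof (rule bexI)
    have "a *\<^sub>R sgn c = (1 - a / 4) *\<^sub>R 0 + (a / 4) *\<^sub>R (4 *\<^sub>R sgn c)" by simp
    then show "a *\<^sub>R sgn c \<in> convex hull {0, 4 *\<^sub>R sgn c}"
      using a_lower a_upper unfolding convex_hull_2 by (intro CollectI exI[of _ "1 - a/4"] exI[of _ "a/4"]) auto
    have px: "x = p + D *\<^sub>R sgn (x - p)" using \<open>x \<noteq> p\<close> by (simp add: D_def dist_norm sgn_div_norm)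
    have "push_out H x = p + (40 + D / 1000) *\<^sub>R sgn (x - p)" by (simp add: push_out_def p_def D_def)
    also have "\<dots> = (p + D *\<^sub>R sgn (x - p)) + (40 + D / 1000 - D) *\<^sub>R sgn (x - p)"
      by (simp only: add.assoc scaleR_add_left[symmetric]) simp
    also have "p + D *\<^sub>R sgn (x - p) = a *\<^sub>R sgn c + b *\<^sub>R z" using px x by simp
    finally have "push_out H x - a *\<^sub>R sgn c = b *\<^sub>R z + (40 + D / 1000 - D) *\<^sub>R sgn (x - p)" by simp
    also have "norm \<dots> \<le> b * t + \<bar>40 + D / 1000 - D\<bar>"
      using norm_triangle_ineq[of "b *\<^sub>R z" "(40 + D / 1000 - D) *\<^sub>R sgn (x - p)"] b \<open>x \<noteq> p\<close>
      by (simp add: t_def norm_sgn)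
    also have "\<dots> = b * t + (40 + D / 1000 - D)" using D0 D40 by simp
    also have "\<dots> \<le> 40 - g / 2" using D_lower bt g by linarith
    finally show "norm (push_out H x - a *\<^sub>R sgn c) \<le> 40 - norm z / (64 * \<rho>)" by (simp add: g_def t_def)
  qed
qed

text \<open>After rescaling and pushing, the tubes of all scales lie in one ball of fixed radius.
  Pairs of equal scale are separated by the grid lemma and the Lipschitz inverse of
  \<open>push_out\<close>, pairs of different scales by \<open>push_out_separated\<close>, so a
  single volume comparison avoids a factor counting the scales.\<close>

lemma card_far_le:
  fixes c :: "'i \<Rightarrow> 'a::euclidean_space" and r \<rho> :: "'i \<Rightarrow> real"
  assumes fin: "finite I" and \<delta>: "0 < \<delta>" "\<delta> < 1/2"
    and W: "\<And>a. witnessed \<delta> a {i \<in> I. \<rho> i = a} c r z"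
    and \<rho>: "\<And>i. i \<in> I \<Longrightarrow> 0 < \<rho> i"
    and gap: "\<And>i j. i \<in> I \<Longrightarrow> j \<in> I \<Longrightarrow> \<rho> i < \<rho> j \<Longrightarrow> 64 * \<rho> i \<le> \<rho> j"
    and older: "\<And>i j. i \<in> I \<Longrightarrow> j \<in> I \<Longrightarrow> \<rho> i < \<rho> j \<Longrightarrow> r j \<le> norm (z i - c j)"
    and c: "\<And>i. i \<in> I \<Longrightarrow> norm (c i) < r i" "\<And>i. i \<in> I \<Longrightarrow> 3 * r i \<le> 4 * norm (c i)"
    and shallow: "\<And>i. i \<in> I \<Longrightarrow> r i - norm (z i - c i) \<le> \<rho> i / 8"
    and z: "\<And>i. i \<in> I \<Longrightarrow> (norm (z i))\<^sup>2 \<le> 4 * (z i \<bullet> c i)" "\<And>i. i \<in> I \<Longrightarrow> sqrt \<delta> * \<rho> i \<le> norm (z i)"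
  shows "real (card I) \<le> (3 * 45180) ^ DIM('a) * sqrt (2 / \<delta>) ^ (DIM('a) - 1)"
proof -
  \<comment> \<open>The sets \<open>H a\<close> grow as the scale \<open>a\<close> decreases. In units of its own scale, the ball \<open>i\<close> has its
    level points outside \<open>H (\<rho> i)\<close>, but almost on the segment towards \<open>4 sgn (c i)\<close>, which lies in
    the sets \<open>H a\<close> of all smaller scales.\<close>
  define H where "H a = convex hull (insert 0 ((\<lambda>j. 4 *\<^sub>R sgn (c j)) ` {j \<in> I. a < \<rho> j}))" for a
  define x where "x i l = (8 / \<rho> i) *\<^sub>R level_point (c i) (r i) (z i) (l * \<rho> i / 8)" for i l
  define y where "y i l = push_out (H (\<rho> i)) (x i l)" for i l
  \<comment> \<open>Scaled by \<open>\<rho> i / 8\<close> this spacing gives equality in the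
    requirement of \<open>witnessed_grid_separated\<close> with
    \<open>\<sigma> = \<rho> i / 8\<close>.\<close>
  define \<eta> where "\<eta> = sqrt (\<delta> / 2)"
  define M where "M = nat \<lfloor>1 / \<eta>\<rfloor>"
  have \<eta>: "0 < \<eta>" "\<eta> < 1" "\<eta> \<le> sqrt \<delta>" "\<eta>\<^sup>2 = \<delta> / 2"
    using \<delta> by (simp_all add: \<eta>_def)
  have M: "1 / \<eta> \<le> real M + 1" "real M * \<eta> \<le> 1"
  proof -
    have "real M = of_int \<lfloor>1 / \<eta>\<rfloor>" using \<eta> by (simp add: M_def)
    then have "real M \<le> 1 / \<eta>" "1 / \<eta> \<le> real M + 1" by linarith+
    then show "1 / \<eta> \<le> real M + 1" "real M * \<eta> \<le> 1" using \<eta> by (simp_all add: pos_le_divide_eq)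
  qed
  have mM: "real m * \<eta> \<le> 1" if "m \<le> M" for m
  proof -
    have "real m * \<eta> \<le> real M * \<eta>" using that \<eta> by (intro mult_right_mono) auto
    with M(2) show ?thesis by linarith
  qed
  have in_class: "\<rho> i \<le> r i" "r i < 2 * \<rho> i" "norm (z i - c i) < r i" if "i \<in> I" for i
    using W[of "\<rho> i"] that by (auto simp: witnessed_def)
  have z0: "z i \<noteq> 0" "0 < norm (z i)" if "i \<in> I" for i
  proof -
    have "0 < sqrt \<delta> * \<rho> i" using \<delta> \<rho>[OF that] by simp
    with z(2)[OF that] show "0 < norm (z i)" by linarith
    then show "z i \<noteq> 0" by simp
  qed
  have H: "convex (H a)" "closed (H a)" "0 \<in> H a" for a
    using fin by (auto simp: H_def intro!: compact_imp_closed finite_imp_compact_convex_hull hull_inc)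
  have H_ball: "H a \<subseteq> cball 0 4" for a
    unfolding H_def by (rule hull_minimal) (auto simp: norm_sgn)
  have H_le: "z i \<bullet> h \<le> (norm (z i))\<^sup>2 / (24 * \<rho> i)" if i: "i \<in> I" and h: "h \<in> H (\<rho> i)" for i h
  proof -
    have "H (\<rho> i) \<subseteq> {h. z i \<bullet> h \<le> (norm (z i))\<^sup>2 / (24 * \<rho> i)}"
      unfolding H_def
    proof (rule hull_minimal)
      show "insert 0 ((\<lambda>j. 4 *\<^sub>R sgn (c j)) ` {j \<in> I. \<rho> i < \<rho> j})
          \<subseteq> {h. z i \<bullet> h \<le> (norm (z i))\<^sup>2 / (24 * \<rho> i)}"
      proof (clarsimp, intro conjI ballI impI subsetI)
        show "0 \<le> (norm (z i))\<^sup>2 / (24 * \<rho> i)" using \<rho>[OF i] by simp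
      next
        fix v assume "v \<in> (\<lambda>j. 4 *\<^sub>R sgn (c j)) ` {j \<in> I. \<rho> i < \<rho> j}"
        then obtain j where j: "j \<in> I" "\<rho> i < \<rho> j" and v: "v = 4 *\<^sub>R sgn (c j)" by auto
        have cj: "48 * \<rho> i \<le> norm (c j)" using gap[OF i j] c(2)[OF j(1)] in_class[OF j(1)] by linarith
        then have cj0: "0 < norm (c j)" using \<rho>[OF i] by linarith
        \<comment> \<open>The origin lies in the larger ball \<open>j\<close> and \<open>z i\<close>
          does not, so \<open>c j\<close> is on the origin's side of the bisecting hyperplane of 0
          and \<open>z i\<close>.\<close>
        have "(norm (c j))\<^sup>2 \<le> (norm (z i - c j))\<^sup>2"
          using older[OF i j] c(1)[OF j(1)] by (intro power_mono) auto
        then have "2 * (z i \<bullet> c j) \<le> (norm (z i))\<^sup>2"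
          unfolding power2_norm_eq_inner by (simp add: inner_diff inner_commute)
        then have "z i \<bullet> v \<le> 2 * (norm (z i))\<^sup>2 / norm (c j)"
          using cj0 by (simp add: v sgn_div_norm field_simps)
        also have "\<dots> \<le> 2 * (norm (z i))\<^sup>2 / (48 * \<rho> i)"
          using cj cj0 \<rho>[OF i] by (intro divide_left_mono) auto
        finally show "v \<in> {h. z i \<bullet> h \<le> (norm (z i))\<^sup>2 / (24 * \<rho> i)}" by simp
      qed
      show "convex {h. z i \<bullet> h \<le> (norm (z i))\<^sup>2 / (24 * \<rho> i)}" by (rule convex_halfspace_le)
    qed
    with h show ?thesis by blast
  qed
  have out: "x i l \<notin> H (\<rho> i)" "dist (x i l) (closest_point (H (\<rho> i)) (x i l)) \<le> 40"
    "\<exists>h \<in> convex hull {0, 4 *\<^sub>R sgn (c i)}. norm (y i l - h) \<le> 40 - norm (z i) / (64 * \<rho> i)"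
    if "i \<in> I" "2 \<le> l" "l \<le> 3" for i l
    using push_out_level_point[OF in_class(1,2)[OF that(1)] c[OF that(1)] z0(1)[OF that(1)]
        in_class(3)[OF that(1)] shallow[OF that(1)] z(1)[OF that(1)] H H_le[OF that(1)] that(2,3)]
    by (auto simp: x_def y_def)
  have across: "\<eta> / 1004 \<le> norm (y i l - y j l')"
    if ij: "i \<in> I" "j \<in> I" "\<rho> i < \<rho> j" and l: "2 \<le> l" "l \<le> 3" "2 \<le> l'" "l' \<le> 3" for i j l l'
  proof -
    obtain h where h: "h \<in> convex hull {0, 4 *\<^sub>R sgn (c j)}"
      and yh: "norm (y j l' - h) \<le> 40 - norm (z j) / (64 * \<rho> j)" using out(3) ij l by blast
    have "convex hull {0, 4 *\<^sub>R sgn (c j)} \<subseteq> H (\<rho> i)"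
      unfolding H_def by (rule hull_mono) (use ij in auto)
    then have "h \<in> H (\<rho> i)" using h by blast
    then have "norm (z j) / (64 * \<rho> j) \<le> norm (y i l - y j l')"
      unfolding y_def[of i] using H out(1) ij l yh by (intro push_out_separated) auto
    moreover have "sqrt \<delta> / 64 \<le> norm (z j) / (64 * \<rho> j)"
      using z(2) \<rho> ij by (simp add: field_simps)
    moreover have "\<eta> / 1004 \<le> sqrt \<delta> / 64" using \<eta> by linarith
    ultimately show ?thesis by linarith
  qed
  \<comment> \<open>The radius 45 is 4 for the nearest point in \<open>H\<close> plus at most 41 for
    the push, and \<open>45180 = 45 * 1004\<close>.\<close>
  have "real (card I) \<le> (3 * 45180) ^ DIM('a) * (1 / \<eta>) ^ (DIM('a) - 1)"
  proof (rule card_le_of_tubes[where M = M and \<eta> = "\<eta> / 1004" and L = 45 and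
        f = "\<lambda>i m. y i (2 + real m * \<eta>)"])
    fix i m assume im: "i \<in> I" "m \<le> M"
    have l: "2 \<le> 2 + real m * \<eta>" "2 + real m * \<eta> \<le> 3" using mM[OF im(2)] \<eta> by auto
    define p where "p = closest_point (H (\<rho> i)) (x i (2 + real m * \<eta>))"
    have "p \<in> H (\<rho> i)" using H unfolding p_def by (intro closest_point_in_set) auto
    then have "norm p \<le> 4" using H_ball by force
    moreover have "norm (y i (2 + real m * \<eta>) - p) \<le> 41"
      using out(1,2)[OF im(1) l] by (simp add: y_def push_out_def p_def[symmetric] norm_sgn)
    ultimately show "norm (y i (2 + real m * \<eta>)) \<le> 45"
      using norm_triangle_ineq[of "y i (2 + real m * \<eta>) - p" p] by simp
  next
    fix i m j k assume ij: "i \<in> I" "j \<in> I" and mk: "m \<le> M" "k \<le> M" and ne: "(i, m) \<noteq> (j, k)"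
    have l: "2 \<le> 2 + real m * \<eta>" "2 + real m * \<eta> \<le> 3" "2 \<le> 2 + real k * \<eta>" "2 + real k * \<eta> \<le> 3"
      using mM[OF mk(1)] mM[OF mk(2)] \<eta> by auto
    consider "\<rho> i < \<rho> j" | "\<rho> j < \<rho> i" | "\<rho> i = \<rho> j" by linarith
    then show "\<eta> / 1004 \<le> dist (y i (2 + real m * \<eta>)) (y j (2 + real k * \<eta>))"
    proof cases
      case 1
      then show ?thesis using across[OF ij] l by (simp add: dist_norm)
    next
      case 2
      then show ?thesis using across[OF ij(2,1)] l by (simp add: dist_norm norm_minus_commute)
    next
      case 3
      define e where "e = \<eta> * \<rho> i / 8"
      have \<rho>i: "0 < \<rho> i" by (rule \<rho>[OF ij(1)])
      have "e \<le> dist (level_point (c i) (r i) (z i) (2 * (\<rho> i / 8) + real m * e))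
                      (level_point (c j) (r j) (z j) (2 * (\<rho> i / 8) + real k * e))"
      proof (rule witnessed_grid_separated[OF W[of "\<rho> i"]])
        have "16 * e\<^sup>2 = 16 * (\<delta> / 2) * (\<rho> i)\<^sup>2 / 64"
          by (simp add: e_def power_mult_distrib power_divide \<eta>(4))
        then show "16 * e\<^sup>2 \<le> \<rho> i / 8 * \<delta> * \<rho> i" by (simp add: power2_eq_square)
        have "real m * \<eta> * (\<rho> i / 8) \<le> 1 * (\<rho> i / 8)" "real k * \<eta> * (\<rho> i / 8) \<le> 1 * (\<rho> i / 8)"
          using mM mk \<rho>i by (intro mult_right_mono; simp)+
        then show "real m * e \<le> \<rho> i / 8" "real k * e \<le> \<rho> i / 8" by (simp_all add: e_def)
        show "r l - norm (z l - c l) \<le> \<rho> i / 8" if "l \<in> {l \<in> I. \<rho> l = \<rho> i}" for l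
          using shallow[of l] that by simp
      qed (use ij 3 ne \<delta> \<rho>i \<eta> in \<open>auto simp: e_def\<close>)
      moreover have lev: "2 * (\<rho> i / 8) + real m * e = (2 + real m * \<eta>) * \<rho> i / 8" for m
        by (simp add: e_def algebra_simps)
      ultimately have "e \<le> norm (level_point (c i) (r i) (z i) ((2 + real m * \<eta>) * \<rho> i / 8) -
          level_point (c j) (r j) (z j) ((2 + real k * \<eta>) * \<rho> i / 8))"
        unfolding lev dist_norm by simp
      then have "8 / \<rho> i * e \<le> 8 / \<rho> i * norm (level_point (c i) (r i) (z i) ((2 + real m * \<eta>) * \<rho> i / 8) -
          level_point (c j) (r j) (z j) ((2 + real k * \<eta>) * \<rho> i / 8))"
        using \<rho>i by (intro mult_left_mono) auto
      also have "\<dots> = norm (x i (2 + real m * \<eta>) - x j (2 + real k * \<eta>))"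
        using \<rho>i by (simp add: x_def 3[symmetric] scaleR_diff_right[symmetric])
      also have "\<dots> \<le> 1004 * norm (y i (2 + real m * \<eta>) - y j (2 + real k * \<eta>))"
        unfolding y_def 3[symmetric]
        using out(1,2)[OF ij(1) l(1,2)] out(1,2)[OF ij(2) l(3,4)] H 3
        by (intro norm_diff_le_push_out) auto
      finally show ?thesis using \<rho>i by (simp add: e_def dist_norm)
    qed
  qed (use fin \<eta> M in auto)
  moreover have "1 / \<eta> = sqrt (2 / \<delta>)" by (simp add: \<eta>_def real_sqrt_divide)
  ultimately show ?thesis by simp
qed

text \<open>\<open>T\<close> consists of selected balls containing the origin, and \<open>k\<close>
  is the dyadic size class. Witnesses near the origin or deep in their balls are summed over the
  classes with geometric decay; the remaining ones go to \<open>card_far_le\<close> in six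
  groups.\<close>

lemma card_overlap_le:
  fixes c :: "'i \<Rightarrow> 'a::euclidean_space" and r :: "'i \<Rightarrow> real" and k :: "'i \<Rightarrow> int"
  assumes dim: "2 \<le> DIM('a)" and fin: "finite T" and \<delta>: "0 < \<delta>" "\<delta> < 1/2"
    and scale: "\<And>i. i \<in> T \<Longrightarrow> 2 powr k i \<le> r i" "\<And>i. i \<in> T \<Longrightarrow> r i < 2 * 2 powr k i"
    and inside: "\<And>i. i \<in> T \<Longrightarrow> norm (z i - c i) < r i"
    and best: "\<And>i j. i \<in> T \<Longrightarrow> j \<in> T \<Longrightarrow> k i = k j \<Longrightarrow> norm (z i - c i) - r i \<le> norm (z i - c j) - r j"
    and older: "\<And>i j. i \<in> T \<Longrightarrow> j \<in> T \<Longrightarrow> k i < k j \<Longrightarrow> (1 + \<delta>) * r j \<le> norm (z i - c j)"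
    and same: "\<And>i j. i \<in> T \<Longrightarrow> j \<in> T \<Longrightarrow> k i = k j \<Longrightarrow> i \<noteq> j \<Longrightarrow>
       (1 + \<delta>) * r j \<le> norm (z i - c j) \<or> (1 + \<delta>) * r i \<le> norm (z j - c i)"
    and zero: "\<And>i. i \<in> T \<Longrightarrow> norm (c i) < r i"
  shows "real (card T) \<le>
    (3 * 297 ^ DIM('a) / (1 - sqrt (1 / sqrt 2)) + 6 * 135540 ^ DIM('a)) * sqrt (2 / \<delta>) ^ (DIM('a) - 1)"
    (is "_ \<le> ?K * _")
proof (cases "T = {}")
  case True
  have "sqrt (1 / sqrt 2) < 1" by simp
  then show ?thesis using True \<delta> by (intro order_trans[OF _ mult_nonneg_nonneg]) auto
next
  case False
  define n where "n = DIM('a)"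
  obtain i\<^sub>0 where i0: "i\<^sub>0 \<in> T" and r_min: "\<And>i. i \<in> T \<Longrightarrow> r i\<^sub>0 \<le> r i"
    using arg_min_if_finite[OF fin False, of r] by (meson not_le)
  define R where "R = r i\<^sub>0"
  define P where "P = 2 powr k i\<^sub>0"
  define l where "l i = nat (k i - k i\<^sub>0)" for i
  define \<rho> where "\<rho> i = 2 powr k i" for i
  \<comment> \<open>Since \<open>\<rho> i = P * 2 ^ l i\<close>, the power \<open>u ^ l i\<close>
    equals \<open>sqrt (P / \<rho> i)\<close>, so \<open>\<rho> i * u ^ l i\<close> is the geometric
    mean of the smallest scale and the scale of \<open>i\<close>.\<close>
  define u where "u = 1 / sqrt 2"
  have u: "0 < u" "u < 1" "u\<^sup>2 = 1/2" by (simp_all add: u_def power_divide)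
  have u_sq: "(u ^ m)\<^sup>2 = 1 / 2 ^ m" for m
    by (simp add: u(3) power_mult[symmetric] mult.commute[of m 2])
       (simp add: power_mult u(3) power_one_over)
  have u_le: "u ^ m \<le> 1" for m using u by (simp add: power_le_one)
  have P: "0 < P" by (simp add: P_def)
  have k_min: "k i\<^sub>0 \<le> k i" if "i \<in> T" for i
  proof (rule ccontr)
    assume "\<not> k i\<^sub>0 \<le> k i"
    then have "2 powr (k i + 1) \<le> 2 powr k i\<^sub>0" by (intro powr_mono) auto
    then have "2 * 2 powr k i \<le> 2 powr k i\<^sub>0" by (simp add: powr_add)
    then show False using scale[OF that] scale(1)[OF i0] r_min[OF that] by linarith
  qed
  have \<rho>: "\<rho> i = P * 2 ^ l i" if "i \<in> T" for i
  proof -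
    have "real_of_int (k i) = real_of_int (k i\<^sub>0) + real (l i)" using k_min[OF that] by (simp add: l_def)
    then show ?thesis by (simp add: \<rho>_def P_def powr_add powr_realpow)
  qed
  have \<rho>0: "0 < \<rho> i" for i by (simp add: \<rho>_def)
  have sc: "\<rho> i \<le> r i" "r i < 2 * \<rho> i" if "i \<in> T" for i using scale[OF that] by (simp_all add: \<rho>_def)
  have R: "0 < R" "R < 2 * P" using scale[OF i0] P by (simp_all add: R_def P_def)
  have z4: "norm (z i) \<le> 4 * \<rho> i" if "i \<in> T" for i
    using norm_triangle_ineq[of "z i - c i" "c i"] inside[OF that] zero[OF that] sc[OF that] by simp
  \<comment> \<open>The witness of the smallest ball lies within \<open>2 * R\<close> of the origin
    but outside the dilate of every ball of a higher class. So the origin is close to the boundary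
    of such a ball, and its radius is at most \<open>2 * R / \<delta>\<close>.\<close>
  have centre: "r i - 2 * R \<le> norm (c i)" "\<delta> * r i \<le> 2 * R" if "i \<in> T" "0 < l i" for i
  proof -
    have "k i\<^sub>0 < k i" using that by (simp add: l_def)
    then have "(1 + \<delta>) * r i \<le> norm (z i\<^sub>0 - c i)" by (rule older[OF i0 that(1)])
    moreover have "norm (z i\<^sub>0) \<le> 2 * R"
      using norm_triangle_ineq[of "z i\<^sub>0 - c i\<^sub>0" "c i\<^sub>0"] inside[OF i0] zero[OF i0] by (simp add: R_def)
    moreover have "norm (z i\<^sub>0 - c i) \<le> norm (z i\<^sub>0) + norm (c i)" by (rule norm_triangle_ineq4)
    moreover have "(1 + \<delta>) * r i = r i + \<delta> * r i" by (simp add: algebra_simps)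
    moreover have "0 \<le> \<delta> * r i" using \<delta> sc[OF that(1)] \<rho>0[of i] by simp
    ultimately show "r i - 2 * R \<le> norm (c i)" "\<delta> * r i \<le> 2 * R" using zero[OF that(1)] by linarith+
  qed
  have \<delta>_le: "\<delta> * 2 ^ l i \<le> 4" if "i \<in> T" for i
  proof (cases "l i = 0")
    case False
    have "\<delta> * \<rho> i \<le> \<delta> * r i" using \<delta> sc[OF that] by simp
    also have "\<dots> \<le> 4 * P" using centre(2)[OF that] False R by linarith
    finally show ?thesis using P by (simp add: \<rho>[OF that])
  qed (use \<delta> in simp)
  have \<delta>_u: "\<delta> \<le> 2 * u ^ l i" "sqrt \<delta> \<le> 2 * u ^ l i" if "i \<in> T" for i
  proof -
    have "\<delta> \<le> 4 * (u ^ l i)\<^sup>2" using \<delta>_le[OF that] by (simp add: u_sq pos_le_divide_eq)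
    then have *: "\<delta> \<le> (2 * u ^ l i)\<^sup>2" by (simp add: power_mult_distrib)
    then show "sqrt \<delta> \<le> 2 * u ^ l i" using u by (intro real_le_lsqrt) auto
    have "\<delta>\<^sup>2 \<le> \<delta>" using \<delta> by (simp add: power2_eq_square mult_left_le)
    with * have "\<delta>\<^sup>2 \<le> (2 * u ^ l i)\<^sup>2" by linarith
    then show "\<delta> \<le> 2 * u ^ l i" by (rule power2_le_imp_le) (use u in simp)
  qed
  have W: "witnessed \<delta> a J c r z" if J: "J \<subseteq> T" "\<And>i. i \<in> J \<Longrightarrow> \<rho> i = a" for a J
  proof -
    have kk: "k i = k j" if "i \<in> J" "j \<in> J" for i j
    proof -
      have "2 powr real_of_int (k i) = 2 powr real_of_int (k j)"
        using J(2)[OF that(1)] J(2)[OF that(2)] by (simp add: \<rho>_def)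
      then have "real_of_int (k i) = real_of_int (k j)" by (subst (asm) powr_inj) auto
      then show ?thesis by linarith
    qed
    have JT: "i \<in> T" if "i \<in> J" for i using J that by auto
    show ?thesis
      unfolding witnessed_def
    proof (intro conjI ballI impI)
      show "finite J" using J fin by (blast intro: finite_subset)
    next
      fix i assume i: "i \<in> J"
      show "a \<le> r i" "r i < 2 * a" "norm (z i - c i) < r i"
        using sc[OF JT[OF i]] J(2)[OF i] inside[OF JT[OF i]] by simp_all
    next
      fix i j assume ij: "i \<in> J" "j \<in> J"
      show "norm (z i - c i) - r i \<le> norm (z i - c j) - r j"
        by (rule best[OF JT JT kk]) (use ij in auto)
      show "(1 + \<delta>) * r j \<le> norm (z i - c j) \<or> (1 + \<delta>) * r i \<le> norm (z j - c i)" if "i \<noteq> j"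
        by (rule same[OF JT JT kk that]) (use ij in auto)
    qed
  qed
  define depth where "depth i = r i - norm (z i - c i)" for i
  define \<sigma> where "\<sigma> i = \<rho> i * u ^ l i / 8" for i
  have \<sigma>: "0 < \<sigma> i" "8 * \<sigma> i \<le> \<rho> i" for i
    using \<rho>0[of i] u u_le[of "l i"] by (simp_all add: \<sigma>_def mult_left_le)
  define V where "V m = sqrt (2 * u ^ m / \<delta>) ^ (n - 1)" for m
  have V1: "1 \<le> V (l i)" if "i \<in> T" for i
    unfolding V_def using \<delta>_u(1)[OF that] \<delta> by (intro one_le_power) simp
  \<comment> \<open>\<open>\<sigma> i\<close> is comparable to \<open>sqrt (R * \<rho> i)\<close>: a witness farther away than this sees the origin as
    lying on the boundary of its ball. The near witnesses are counted scale by scale, with a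
    geometric decay in the scale.\<close>
  define Near where "Near m = {i \<in> T. l i = m \<and> norm (z i) \<le> 96 * \<sigma> i \<and> depth i \<le> \<sigma> i}" for m
  define Deep where "Deep m = {i \<in> T. l i = m \<and> norm (z i) \<le> 96 * \<sigma> i \<and> \<sigma> i < depth i}" for m
  define Core where "Core m = {i \<in> T. l i = m \<and> \<rho> i / 8 < depth i}" for m
  \<comment> \<open>Splitting by \<open>l i mod 6\<close> makes distinct scales in one group differ
    by at least \<open>2 ^ 6 = 64\<close>, the gap demanded by \<open>card_far_le\<close>.\<close>
  define Far where "Far a = {i \<in> T. l i mod 6 = a \<and> 96 * \<sigma> i < norm (z i) \<and> depth i \<le> \<rho> i / 8}" for a
  have T_eq: "T \<subseteq> (\<Union>m\<in>l ` T. Near m \<union> Deep m \<union> Core m) \<union> (\<Union>a<6. Far a)"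
    by (auto simp: Near_def Deep_def Core_def Far_def not_le not_less)
  have level: "real (card (Near m \<union> Deep m \<union> Core m)) \<le> 3 * 297 ^ n * V m" if m: "m \<in> l ` T" for m
  proof -
    obtain i where i: "i \<in> T" "l i = m" using m by auto
    have \<rho>m: "\<rho> j = \<rho> i" "\<sigma> j = \<sigma> i" if "j \<in> T" "l j = m" for j
      using \<rho> i that by (simp_all add: \<sigma>_def)
    have V: "1 \<le> V m" using V1 i by auto
    have WJ: "witnessed \<delta> (\<rho> i) J c r z" if "J \<subseteq> T" "\<And>j. j \<in> J \<Longrightarrow> l j = m" for J
      by (rule W) (use that \<rho>m in auto)
    have "real (card (Near m)) \<le> (3 * (96 + 3)) ^ DIM('a) * sqrt (16 * \<sigma> i / (\<delta> * \<rho> i)) ^ (DIM('a) - 1)"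
    proof (rule card_shallow_le[OF WJ])
      show "\<delta> * \<rho> i \<le> 16 * \<sigma> i"
        using \<delta>_u(1)[OF i(1)] \<rho>0[of i] by (simp add: \<sigma>_def)
    qed (use \<delta> \<sigma>[of i] \<rho>m in \<open>auto simp: Near_def depth_def\<close>)
    also have "16 * \<sigma> i / (\<delta> * \<rho> i) = 2 * u ^ m / \<delta>"
      using \<rho>0[of i] i by (simp add: \<sigma>_def)
    finally have near: "real (card (Near m)) \<le> 297 ^ n * V m" by (simp add: V_def n_def)
    have "real (card (Deep m)) \<le> (3 * 96) ^ DIM('a)"
      by (rule card_deep_le[OF WJ, where \<sigma> = "\<sigma> i"])
         (use \<delta> \<sigma>[of i] \<rho>0[of i] \<rho>m in \<open>auto simp: Deep_def depth_def less_imp_le\<close>)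
    also have "\<dots> \<le> 297 ^ n * 1" unfolding n_def by (simp add: power_mono)
    also have "\<dots> \<le> 297 ^ n * V m" using V by (intro mult_left_mono) auto
    finally have deep: "real (card (Deep m)) \<le> 297 ^ n * V m" .
    have "real (card (Core m)) \<le> (3 * 32) ^ DIM('a)"
    proof (rule card_deep_le[OF WJ, where \<sigma> = "\<rho> i / 8"])
      fix j assume "j \<in> Core m"
      then have j: "j \<in> T" "l j = m" "\<rho> j / 8 < depth j" by (auto simp: Core_def)
      show "norm (z j) \<le> 32 * (\<rho> i / 8)" using z4[OF j(1)] \<rho>m[OF j(1,2)] by simp
      show "\<rho> i / 8 < r j - norm (z j - c j)" using j(3) \<rho>m[OF j(1,2)] by (simp add: depth_def)
    qed (use \<delta> \<rho>0[of i] in \<open>auto simp: Core_def less_imp_le\<close>)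
    also have "\<dots> \<le> 297 ^ n * 1" unfolding n_def by (simp add: power_mono)
    also have "\<dots> \<le> 297 ^ n * V m" using V by (intro mult_left_mono) auto
    finally have core: "real (card (Core m)) \<le> 297 ^ n * V m" .
    have "card (Near m \<union> Deep m \<union> Core m) \<le> card (Near m) + card (Deep m) + card (Core m)"
      by (meson card_Un_le order_trans add_right_mono)
    then show ?thesis using near deep core by linarith
  qed
  have far: "real (card (Far a)) \<le> 135540 ^ n * sqrt (2 / \<delta>) ^ (n - 1)" for a
  proof -
    have F: "i \<in> T" "l i mod 6 = a" "12 * (\<rho> i * u ^ l i) < norm (z i)" "depth i \<le> \<rho> i / 8"
      if "i \<in> Far a" for i using that by (auto simp: Far_def \<sigma>_def)
    \<comment> \<open>For \<open>l i \<le> 3\<close> the threshold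
      \<open>12 * (\<rho> i * u ^ l i)\<close> is at least \<open>4 * \<rho> i\<close>, which no
      witness exceeds.\<close>
    have l4: "4 \<le> l i" if "i \<in> Far a" for i
    proof (rule ccontr)
      assume "\<not> 4 \<le> l i"
      then have "(2::real) ^ l i \<le> 2 ^ 3" by (intro power_increasing) auto
      then have "1 / 2 ^ 3 \<le> 1 / (2::real) ^ l i" by (intro divide_left_mono) auto
      moreover have "(1/3)\<^sup>2 \<le> 1 / (2::real) ^ 3" by (simp add: power2_eq_square)
      ultimately have "(1/3)\<^sup>2 \<le> (u ^ l i)\<^sup>2" unfolding u_sq by linarith
      then have "1/3 \<le> u ^ l i" by (rule power2_le_imp_le) (use u in simp)
      then have "\<rho> i * (1/3) \<le> \<rho> i * u ^ l i" using \<rho>0[of i] by (intro mult_left_mono) auto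
      then show False using F(3)[OF that] z4[OF F(1)[OF that]] by linarith
    qed
    have R_le: "R \<le> 2 * \<rho> i * (u ^ l i)\<^sup>2" "8 * R \<le> \<rho> i" if "i \<in> Far a" for i
    proof -
      have "2 * \<rho> i * (u ^ l i)\<^sup>2 = 2 * P" using \<rho>[OF F(1)[OF that]] by (simp add: u_sq)
      then show "R \<le> 2 * \<rho> i * (u ^ l i)\<^sup>2" using R by simp
      have "16 \<le> (2::real) ^ l i" using power_increasing[OF l4[OF that], of "2::real"] by simp
      then have "P * 16 \<le> P * 2 ^ l i" using P by (intro mult_left_mono) auto
      then show "8 * R \<le> \<rho> i" using R unfolding \<rho>[OF F(1)[OF that]] by linarith
    qed
    have cR: "r i - 2 * R \<le> norm (c i)" if "i \<in> Far a" for i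
      using centre(1)[OF F(1)[OF that]] l4[OF that] by simp
    have "real (card (Far a)) \<le> (3 * 45180) ^ DIM('a) * sqrt (2 / \<delta>) ^ (DIM('a) - 1)"
    proof (rule card_far_le[where \<rho> = \<rho> and c = c and r = r and z = z])
      show "finite (Far a)" using fin by (simp add: Far_def)
      show "witnessed \<delta> b {i \<in> Far a. \<rho> i = b} c r z" for b
        by (rule W) (use F(1) in auto)
      show "norm (c i) < r i" if "i \<in> Far a" for i by (rule zero[OF F(1)[OF that]])
      show "3 * r i \<le> 4 * norm (c i)" if "i \<in> Far a" for i
        using cR[OF that] R_le(2)[OF that] sc(1)[OF F(1)[OF that]] by linarith
      show "r i - norm (z i - c i) \<le> \<rho> i / 8" if "i \<in> Far a" for i
        using F(4)[OF that] by (simp add: depth_def)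
      show "sqrt \<delta> * \<rho> i \<le> norm (z i)" if "i \<in> Far a" for i
      proof -
        have "sqrt \<delta> * \<rho> i \<le> 2 * u ^ l i * \<rho> i"
          using \<delta>_u(2)[OF F(1)[OF that]] \<rho>0[of i] by (intro mult_right_mono) auto
        also have "\<dots> = 2 * (\<rho> i * u ^ l i)" by simp
        also have "\<dots> \<le> 12 * (\<rho> i * u ^ l i)" using \<rho>0[of i] u by (intro mult_right_mono) auto
        finally show ?thesis using F(3)[OF that] by linarith
      qed
      \<comment> \<open>If the origin were on the sphere about \<open>c i\<close>, the law of
        cosines would give factor 2. The error is at most \<open>4 * R * r i\<close>, hence at most
        a ninth of the square of \<open>norm (z i)\<close>, because the witness is far.\<close>
      show "(norm (z i))\<^sup>2 \<le> 4 * (z i \<bullet> c i)" if i: "i \<in> Far a" for i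
      proof -
        have "(r i - 2 * R)\<^sup>2 \<le> (norm (c i))\<^sup>2"
          using cR[OF i] R_le(2)[OF i] sc(1)[OF F(1)[OF i]] \<rho>0[of i] by (intro power_mono) auto
        moreover have "(norm (z i - c i))\<^sup>2 \<le> (r i)\<^sup>2"
          using inside[OF F(1)[OF i]] by (intro power_mono) auto
        moreover have "(norm (z i - c i))\<^sup>2 = (norm (z i))\<^sup>2 + (norm (c i))\<^sup>2 - 2 * (z i \<bullet> c i)"
          unfolding power2_norm_eq_inner by (simp add: inner_diff inner_commute)
        moreover have "(r i - 2 * R)\<^sup>2 = (r i)\<^sup>2 - 4 * (R * r i) + 4 * R\<^sup>2"
          by (simp add: power2_eq_square algebra_simps)
        moreover have "R * r i \<le> (2 * \<rho> i * (u ^ l i)\<^sup>2) * (2 * \<rho> i)"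
          using R_le(1)[OF i] sc[OF F(1)[OF i]] R \<rho>0[of i] by (intro mult_mono) auto
        moreover have "(2 * \<rho> i * (u ^ l i)\<^sup>2) * (2 * \<rho> i) = 4 * (\<rho> i * u ^ l i)\<^sup>2"
          by (simp add: power2_eq_square)
        moreover have "(12 * (\<rho> i * u ^ l i))\<^sup>2 \<le> (norm (z i))\<^sup>2"
          using F(3)[OF i] \<rho>0[of i] u by (intro power_mono) auto
        moreover have "(12 * (\<rho> i * u ^ l i))\<^sup>2 = 144 * (\<rho> i * u ^ l i)\<^sup>2" by (simp add: power_mult_distrib)
        moreover have "0 \<le> (\<rho> i * u ^ l i)\<^sup>2" "0 \<le> R\<^sup>2" by simp_all
        ultimately show ?thesis by linarith
      qed
    next
      fix i j assume ij: "i \<in> Far a" "j \<in> Far a" "\<rho> i < \<rho> j"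
      have "(2::real) ^ l i < 2 ^ l j" using ij(3) \<rho> F(1) ij(1,2) P by simp
      then have ll: "l i < l j" by simp
      moreover have "l i mod 6 = l j mod 6" using F(2) ij by simp
      ultimately have "6 \<le> l j - l i"
        by (metis dvd_imp_le mod_eq_dvd_iff_nat less_imp_le zero_less_diff)
      then have "(2::real) ^ (l i + 6) \<le> 2 ^ l j" by (intro power_increasing) auto
      then have "P * 2 ^ (l i + 6) \<le> P * 2 ^ l j" using P by (intro mult_left_mono) auto
      then show "64 * \<rho> i \<le> \<rho> j" using \<rho> F(1) ij by (simp add: power_add)
      have "k i < k j" using ll by (simp add: l_def)
      then have "(1 + \<delta>) * r j \<le> norm (z i - c j)" using older F(1) ij by blast
      moreover have "0 \<le> \<delta> * r j" using \<delta> sc[OF F(1)[OF ij(2)]] \<rho>0[of j] by simp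
      ultimately show "r j \<le> norm (z i - c j)" by (simp add: algebra_simps)
    qed (use \<delta> \<rho>0 in auto)
    then show ?thesis by (simp add: n_def)
  qed
  \<comment> \<open>The contribution of level \<open>m\<close> decays like
    \<open>w ^ (m * (n - 1))\<close>; dimension at least 2 makes this at most \<open>w ^ m\<close>,
    a convergent geometric series.\<close>
  define w where "w = sqrt u"
  have w: "0 \<le> w" "w < 1" using u by (simp_all add: w_def)
  have n1: "1 \<le> n - 1" using dim by (simp add: n_def)
  have V_le: "V m \<le> sqrt (2 / \<delta>) ^ (n - 1) * w ^ m" for m
  proof -
    have "sqrt (2 * u ^ m / \<delta>) = sqrt (2 / \<delta>) * w ^ m"
      by (simp add: w_def real_sqrt_mult real_sqrt_divide real_sqrt_power)
    then have "V m = sqrt (2 / \<delta>) ^ (n - 1) * (w ^ m) ^ (n - 1)" by (simp add: V_def power_mult_distrib)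
    also have "\<dots> \<le> sqrt (2 / \<delta>) ^ (n - 1) * (w ^ m) ^ 1"
      using w n1 \<delta> by (intro mult_left_mono power_decreasing) (auto simp: power_le_one)
    finally show ?thesis by simp
  qed
  have geom: "(\<Sum>m\<in>l ` T. w ^ m) \<le> 1 / (1 - w)"
    using sum_le_suminf[of "\<lambda>m. w ^ m" "l ` T"] fin w by (simp add: suminf_geometric)
  let ?Q = "sqrt (2 / \<delta>) ^ (n - 1)"
  have Q: "0 \<le> ?Q" using \<delta> by simp
  have "card T \<le> card (\<Union>m\<in>l ` T. Near m \<union> Deep m \<union> Core m) + card (\<Union>a<6. Far a)"
    using fin by (intro order_trans[OF card_mono[OF _ T_eq] card_Un_le])
      (auto simp: Near_def Deep_def Core_def Far_def)
  also have "\<dots> \<le> (\<Sum>m\<in>l ` T. card (Near m \<union> Deep m \<union> Core m)) + (\<Sum>a<6. card (Far a))"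
    using fin by (intro add_mono card_UN_le) auto
  finally have "real (card T) \<le>
      real ((\<Sum>m\<in>l ` T. card (Near m \<union> Deep m \<union> Core m)) + (\<Sum>a<6. card (Far a)))"
    by (rule of_nat_mono)
  also have "\<dots> = (\<Sum>m\<in>l ` T. real (card (Near m \<union> Deep m \<union> Core m))) + (\<Sum>a<6. real (card (Far a)))"
    by simp
  also have "\<dots> \<le> (\<Sum>m\<in>l ` T. 3 * 297 ^ n * (?Q * w ^ m)) + (\<Sum>a<(6::nat). 135540 ^ n * ?Q)"
  proof (intro add_mono sum_mono)
    fix m assume "m \<in> l ` T"
    then have "real (card (Near m \<union> Deep m \<union> Core m)) \<le> 3 * 297 ^ n * V m" by (rule level)
    also have "\<dots> \<le> 3 * 297 ^ n * (?Q * w ^ m)" using V_le by (intro mult_left_mono) auto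
    finally show "real (card (Near m \<union> Deep m \<union> Core m)) \<le> 3 * 297 ^ n * (?Q * w ^ m)" .
  qed (rule far)
  also have "\<dots> = 3 * 297 ^ n * ?Q * (\<Sum>m\<in>l ` T. w ^ m) + 6 * 135540 ^ n * ?Q"
    by (simp add: sum_distrib_left mult.assoc)
  also have "\<dots> \<le> 3 * 297 ^ n * ?Q * (1 / (1 - w)) + 6 * 135540 ^ n * ?Q"
    using geom Q by (intro add_mono mult_left_mono) auto
  also have "\<dots> = (3 * 297 ^ n / (1 - w) + 6 * 135540 ^ n) * ?Q" by (simp add: algebra_simps)
  finally show ?thesis by (simp add: w_def u_def n_def)
qed

subsection \<open>Separated directions\<close>

text \<open>A grid with \<open>m\<close> values in each of \<open>n - 1\<close> coordinates is
  lifted to the sphere as a graph over the remaining coordinate \<open>k\<close>. With mesh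
  \<open>1 / (n * m)\<close> the grid stays in the unit ball, and distinct points differ by at least
  one mesh in some coordinate.\<close>

lemma separated_unit_vectors:
  assumes "0 < m"
  obtains V :: "(real ^ 'n::finite) set" where "finite V" "card V = m ^ (CARD('n) - 1)"
    "\<And>v. v \<in> V \<Longrightarrow> norm v = 1"
    "\<And>v w. v \<in> V \<Longrightarrow> w \<in> V \<Longrightarrow> v \<noteq> w \<Longrightarrow> 1 / (real CARD('n) * real m) \<le> dist v w"
proof -
  define n where "n = CARD('n)"
  define \<epsilon> where "\<epsilon> = 1 / (real n * real m)"
  have n: "0 < n" by (simp add: n_def)
  have \<epsilon>: "0 < \<epsilon>" "\<epsilon> * real m = 1 / real n" using n assms by (simp_all add: \<epsilon>_def)
  obtain k :: 'n where True by simp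
  define F where "F = (UNIV - {k}) \<rightarrow>\<^sub>E {..<m}"
  define q where "q f = (\<Sum>i\<in>UNIV - {k}. (\<epsilon> * real (f i))\<^sup>2)" for f :: "'n \<Rightarrow> nat"
  define v :: "('n \<Rightarrow> nat) \<Rightarrow> real ^ 'n" where
    "v f = (\<chi> i. if i = k then sqrt (1 - q f) else \<epsilon> * real (f i))" for f
  have F: "finite F" "card F = m ^ (n - 1)"
    by (simp_all add: F_def n_def finite_PiE card_PiE card_Diff_singleton)
  have q_le: "q f \<le> 1" if "f \<in> F" for f
  proof -
    have "q f \<le> (\<Sum>i\<in>UNIV - {k}. (1 / real n)\<^sup>2)"
      unfolding q_def
    proof (intro sum_mono power_mono)
      fix i assume "i \<in> UNIV - {k}"
      then have "f i < m" using that by (auto simp: F_def)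
      then have "\<epsilon> * real (f i) \<le> \<epsilon> * real m" using \<epsilon> by (intro mult_left_mono) auto
      then show "\<epsilon> * real (f i) \<le> 1 / real n" using \<epsilon> by simp
    qed (use \<epsilon> in simp)
    also have "\<dots> = real (n - 1) * (1 / real n)\<^sup>2" by (simp add: n_def)
    also have "\<dots> \<le> real n * (1 / real n)\<^sup>2" by (intro mult_right_mono) auto
    also have "\<dots> = 1 / real n" using n by (simp add: power2_eq_square)
    also have "\<dots> \<le> 1" using n by simp
    finally show ?thesis .
  qed
  have norm_v: "norm (v f) = 1" if "f \<in> F" for f
  proof -
    have "(norm (v f))\<^sup>2 = (\<Sum>i\<in>UNIV. (v f $ i)\<^sup>2)"
      unfolding power2_norm_eq_inner inner_vec_def by (simp add: power2_eq_square)
    also have "\<dots> = (v f $ k)\<^sup>2 + (\<Sum>i\<in>UNIV - {k}. (v f $ i)\<^sup>2)"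
      by (rule sum.remove) auto
    also have "(\<Sum>i\<in>UNIV - {k}. (v f $ i)\<^sup>2) = q f"
      unfolding q_def by (rule sum.cong) (auto simp: v_def)
    also have "(v f $ k)\<^sup>2 = 1 - q f" using q_le[OF that] by (simp add: v_def)
    finally have "(norm (v f))\<^sup>2 = 1" by simp
    then show ?thesis by (intro power2_eq_imp_eq[of "norm (v f)" 1]) simp_all
  qed
  have sep: "\<epsilon> \<le> dist (v f) (v g)" if fg: "f \<in> F" "g \<in> F" "f \<noteq> g" for f g
  proof -
    obtain i where i: "f i \<noteq> g i" using fg by blast
    then have ik: "i \<noteq> k" using fg by (auto simp: F_def PiE_def extensional_def)
    have "1 \<le> \<bar>real (f i) - real (g i)\<bar>" using i by linarith
    then have "\<epsilon> * 1 \<le> \<epsilon> * \<bar>real (f i) - real (g i)\<bar>" using \<epsilon> by (intro mult_left_mono) auto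
    also have "\<dots> = dist (v f $ i) (v g $ i)"
      using ik \<epsilon> by (simp add: v_def dist_real_def abs_mult right_diff_distrib[symmetric])
    also have "\<dots> \<le> dist (v f) (v g)" by (rule dist_vec_nth_le)
    finally show ?thesis by simp
  qed
  have "inj_on v F"
  proof (rule inj_onI, rule ccontr)
    fix f g assume "f \<in> F" "g \<in> F" "v f = v g" "f \<noteq> g"
    then show False using sep[of f g] \<epsilon> by simp
  qed
  then have "card (v ` F) = m ^ (CARD('n) - 1)" using F by (simp add: card_image n_def)
  then show thesis
    using F norm_v sep by (intro that[of "v ` F"]) (auto simp: \<epsilon>_def n_def)
qed

text \<open>The extreme point \<open>(3/2) v\<close> of the unit ball about \<open>v/2\<close> stays uncovered when that ball is
  omitted; the ball being open, the proof uses a point slightly inside.\<close>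

lemma half_vector_ball_needed:
  fixes v :: "'a::euclidean_space"
  assumes \<delta>: "0 < \<delta>" "\<delta> < 1/2" and v: "norm v = 1" and w: "\<And>w. w \<in> W \<Longrightarrow> norm w = 1"
    and separated: "\<And>w. w \<in> W \<Longrightarrow> 6 * \<delta> \<le> (dist v w)\<^sup>2"
  shows "\<not> ball ((1/2) *\<^sub>R v) 1 \<subseteq> (\<Union>w\<in>W. ball ((1/2) *\<^sub>R w) (1 + \<delta>))"
proof
  assume sub: "ball ((1/2) *\<^sub>R v) 1 \<subseteq> (\<Union>w\<in>W. ball ((1/2) *\<^sub>R w) (1 + \<delta>))"
  define s where "s = 3/2 - \<delta>/2"
  have s: "5/4 \<le> s" using \<delta> by (simp add: s_def)
  have "s *\<^sub>R v - (1/2) *\<^sub>R v = (s - 1/2) *\<^sub>R v" by (simp add: scaleR_left_diff_distrib)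
  then have "dist ((1/2) *\<^sub>R v) (s *\<^sub>R v) < 1"
    using v \<delta> s by (simp add: dist_norm norm_minus_commute) (simp add: s_def)
  then have "s *\<^sub>R v \<in> ball ((1/2) *\<^sub>R v) 1" by simp
  then have "s *\<^sub>R v \<in> (\<Union>w\<in>W. ball ((1/2) *\<^sub>R w) (1 + \<delta>))" by (rule subsetD[OF sub])
  then obtain w where w_in: "w \<in> W" and "dist ((1/2) *\<^sub>R w) (s *\<^sub>R v) < 1 + \<delta>" by auto
  then have "(norm (s *\<^sub>R v - (1/2) *\<^sub>R w))\<^sup>2 < (1 + \<delta>)\<^sup>2"
    by (intro power_strict_mono) (auto simp: dist_norm norm_minus_commute)
  moreover have vw: "v \<bullet> v = 1" "w \<bullet> w = 1" using v w[OF w_in] by (simp_all add: dot_square_norm)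
  \<comment> \<open>For unit vectors \<open>v \<bullet> w\<close> is 1 minus half the squared
    distance. The separation \<open>6 * \<delta>\<close> then raises the squared norm to at least
    \<open>1 + 11/4 * \<delta>\<close>, above the square of \<open>1 + \<delta>\<close>.\<close>
  have "(norm (s *\<^sub>R v - (1/2) *\<^sub>R w))\<^sup>2 = (s - 1/2)\<^sup>2 + s / 2 * (dist v w)\<^sup>2"
    unfolding dist_norm power2_norm_eq_inner
    by (simp add: inner_diff inner_commute vw power2_eq_square algebra_simps)
  moreover have "5/4 / 2 * (6 * \<delta>) \<le> s / 2 * (dist v w)\<^sup>2"
    using s separated[OF w_in] \<delta> by (intro mult_mono) auto
  moreover have "(s - 1/2)\<^sup>2 = 1 - \<delta> + \<delta>\<^sup>2 / 4" by (simp add: s_def power2_eq_square algebra_simps)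
  moreover have "(1 + \<delta>)\<^sup>2 = 1 + 2 * \<delta> + \<delta>\<^sup>2" by (simp add: power2_eq_square algebra_simps)
  moreover have "\<delta>\<^sup>2 \<le> \<delta> / 2" using \<delta> by (simp add: power2_eq_square)
  moreover have "0 \<le> \<delta>\<^sup>2" by simp
  ultimately show False using \<delta> by linarith
qed

subsection \<open>Families of balls\<close>

lemma sum_indicator_points:
  fixes x :: "real ^ 'n::finite"
  assumes "finite S"
  shows "(\<Sum>B\<in>S. indicator (points B) x :: real) = real (card {B \<in> S. x \<in> points B})"
  using assms by (simp add: indicator_def sum.If_cases Int_def)

lemma ex_bounded_overlap_selection:
  assumes dim: "2 \<le> CARD('n::finite)"
  shows "\<exists>A>0. \<forall>\<delta>::real. 0 < \<delta> \<and> \<delta> < 1/2 \<longrightarrow>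
       (\<forall>\<B> :: 'n eball set. finite_ball_family \<B> \<longrightarrow>
         (\<exists>\<S>\<subseteq>\<B>.
            (\<Union>B\<in>\<B>. points B) \<subseteq> (\<Union>B\<in>\<S>. points (dilate (1 + \<delta>) B)) \<and>
            (\<forall>x. (\<Sum>B\<in>\<S>. indicator (points B) x) \<le> A * \<delta> powr (- ((real CARD('n) - 1) / 2)))))"
proof -
  define n where "n = CARD('n)"
  define \<sigma> where "\<sigma> = (real n - 1) / 2"
  define K :: real where "K = 3 * 297 ^ n / (1 - sqrt (1 / sqrt 2)) + 6 * 135540 ^ n"
  have K: "0 < K"
  proof -
    have "sqrt (1 / sqrt 2) < 1" by simp
    then have "0 \<le> 3 * 297 ^ n / (1 - sqrt (1 / sqrt 2))" by (intro divide_nonneg_nonneg) auto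
    moreover have "(0::real) < 6 * 135540 ^ n" by simp
    ultimately show ?thesis unfolding K_def by linarith
  qed
  have root: "sqrt (2 / \<delta>) ^ (n - 1) = 2 powr \<sigma> * \<delta> powr (- \<sigma>)" if "0 < \<delta>" for \<delta>
  proof -
    have "sqrt (2 / \<delta>) ^ (n - 1) = ((2 / \<delta>) powr (1/2)) powr real (n - 1)"
      using that by (simp add: powr_half_sqrt powr_realpow)
    also have "\<dots> = (2 / \<delta>) powr \<sigma>" using dim by (simp add: powr_powr \<sigma>_def n_def of_nat_diff)
    also have "\<dots> = 2 powr \<sigma> / \<delta> powr \<sigma>" by (rule powr_divide)
    also have "\<dots> = 2 powr \<sigma> * \<delta> powr (- \<sigma>)" by (simp add: powr_minus divide_inverse)
    finally show ?thesis .
  qed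
  show ?thesis
  proof (intro exI[of _ "K * 2 powr \<sigma>"] conjI allI impI)
    show "0 < K * 2 powr \<sigma>" using K by simp
  next
    fix \<delta> :: real and \<B> :: "'n eball set"
    assume \<delta>: "0 < \<delta> \<and> \<delta> < 1/2" and \<B>: "finite_ball_family \<B>"
    \<comment> \<open>Dyadic classes: radii in one class agree up to a factor 2, as
      \<open>card_overlap_le\<close> requires. That lemma is then applied with \<open>x\<close>
      translated to the origin.\<close>
    define k where "k B = \<lfloor>log 2 (snd B)\<rfloor>" for B :: "'n eball"
    have fin: "finite \<B>" and pos: "\<And>B. B \<in> \<B> \<Longrightarrow> 0 < snd B" using \<B> by (auto simp: finite_ball_family_def)
    have "0 \<le> \<delta>" using \<delta> by simp
    show "\<exists>\<S>\<subseteq>\<B>. (\<Union>B\<in>\<B>. points B) \<subseteq> (\<Union>B\<in>\<S>. points (dilate (1 + \<delta>) B)) \<and>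
        (\<forall>x. (\<Sum>B\<in>\<S>. indicator (points B) x) \<le>
          K * 2 powr \<sigma> * \<delta> powr (- ((real CARD('n) - 1) / 2)))"
    proof (rule greedy_selection[OF fin \<open>0 \<le> \<delta>\<close>, of fst snd k])
      fix S z
      assume S: "S \<subseteq> \<B>"
        and cover: "(\<Union>B\<in>\<B>. ball (fst B) (snd B)) \<subseteq> (\<Union>B\<in>S. ball (fst B) ((1 + \<delta>) * snd B))"
        and inside: "\<And>B. B \<in> S \<Longrightarrow> norm (z B - fst B) < snd B"
        and best: "\<And>B C. B \<in> S \<Longrightarrow> C \<in> \<B> \<Longrightarrow> k C = k B \<Longrightarrow>
          norm (z B - fst B) - snd B \<le> norm (z B - fst C) - snd C"
        and older: "\<And>B C. B \<in> S \<Longrightarrow> C \<in> S \<Longrightarrow> k B < k C \<Longrightarrow> (1 + \<delta>) * snd C \<le> norm (z B - fst C)"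
        and same: "\<And>B C. B \<in> S \<Longrightarrow> C \<in> S \<Longrightarrow> k B = k C \<Longrightarrow> B \<noteq> C \<Longrightarrow>
          (1 + \<delta>) * snd C \<le> norm (z B - fst C) \<or> (1 + \<delta>) * snd B \<le> norm (z C - fst B)"
      have "(\<Sum>B\<in>S. indicator (points B) x) \<le> K * 2 powr \<sigma> * \<delta> powr (- ((real CARD('n) - 1) / 2))" for x
      proof -
        define T where "T = {B \<in> S. x \<in> points B}"
        have T: "B \<in> S" "B \<in> \<B>" "norm (fst B - x) < snd B" if "B \<in> T" for B
          using that S by (auto simp: T_def points_def dist_norm)
        have "real (card T) \<le> K * sqrt (2 / \<delta>) ^ (n - 1)"
          unfolding K_def n_def
        proof (rule order_trans[OF card_overlap_le[where c = "\<lambda>B. fst B - x" and r = snd and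
                z = "\<lambda>B. z B - x" and k = k and T = T and \<delta> = \<delta>]])
          show "finite T" using fin S by (auto simp: T_def intro: finite_subset)
          fix B assume B: "B \<in> T"
          have r: "0 < snd B" by (rule pos[OF T(2)[OF B]])
          then have "2 powr log 2 (snd B) = snd B" by simp
          moreover have "2 powr k B \<le> 2 powr log 2 (snd B)" unfolding k_def by (intro powr_mono) auto
          moreover have "2 powr log 2 (snd B) < 2 powr (k B + 1)"
            unfolding k_def by (intro powr_less_mono) linarith+
          moreover have "2 powr (k B + 1) = 2 * 2 powr k B" by (simp add: powr_add)
          ultimately show "2 powr k B \<le> snd B" "snd B < 2 * 2 powr k B" by linarith+
        qed (use dim \<delta> T inside best older same in auto)
        also have "\<dots> = K * 2 powr \<sigma> * \<delta> powr (- \<sigma>)" using \<delta> root[of \<delta>] by simp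
        finally show ?thesis
          using sum_indicator_points[of S x] finite_subset[OF S fin] by (simp add: T_def \<sigma>_def n_def)
      qed
      then show ?thesis
        using S cover by (intro exI[of _ S]) (simp add: points_def dilate_def)
    qed
  qed
qed

text \<open>\<open>\<delta>\<close> is chosen so that \<open>6 * \<delta>\<close> is the square of
  the separation of the unit vectors. Every half-vector ball is then needed, so the whole family is
  selected, and all its members contain the origin.\<close>

lemma overlap_lower_bound:
  fixes N :: real
  assumes m: "0 < m" and \<delta>_def: "\<delta> = 1 / (6 * (real CARD('n::finite) * real m)\<^sup>2)"
    and selection: "\<And>\<B> :: 'n eball set. finite_ball_family \<B> \<Longrightarrow> equal_radii \<B> \<Longrightarrow>
      \<exists>\<S>\<subseteq>\<B>. (\<Union>B\<in>\<B>. points B) \<subseteq> (\<Union>B\<in>\<S>. points (dilate (1 + \<delta>) B)) \<and>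
        (\<forall>x. (\<Sum>B\<in>\<S>. indicator (points B) x) \<le> N)"
  shows "real m ^ (CARD('n) - 1) \<le> N"
proof -
  have nm: "1 \<le> real CARD('n) * real m" using m by (simp add: Suc_leI flip: of_nat_mult)
  have "1 \<le> (real CARD('n) * real m)\<^sup>2" using nm by (rule one_le_power)
  then have \<delta>: "0 < \<delta>" "\<delta> < 1/2" by (auto simp: \<delta>_def field_simps)
  obtain V :: "(real ^ 'n) set" where V: "finite V" "card V = m ^ (CARD('n) - 1)"
    "\<And>v. v \<in> V \<Longrightarrow> norm v = 1"
    "\<And>v w. v \<in> V \<Longrightarrow> w \<in> V \<Longrightarrow> v \<noteq> w \<Longrightarrow> 1 / (real CARD('n) * real m) \<le> dist v w"
    using separated_unit_vectors[OF m] by blast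
  define b :: "real ^ 'n \<Rightarrow> 'n eball" where "b v = ((1/2) *\<^sub>R v, 1)" for v
  have inj: "inj b" by (auto simp: b_def inj_def)
  obtain S where S: "S \<subseteq> b ` V"
    and cover: "(\<Union>B\<in>b ` V. points B) \<subseteq> (\<Union>B\<in>S. points (dilate (1 + \<delta>) B))"
    and bound: "\<And>x. (\<Sum>B\<in>S. indicator (points B) x) \<le> N"
    using selection[of "b ` V"] V(1) by (auto simp: finite_ball_family_def equal_radii_def b_def)
  have "b v \<in> S" if v: "v \<in> V" for v
  proof (rule ccontr)
    assume "b v \<notin> S"
    define W where "W = {w \<in> V. b w \<in> S}"
    have "S = b ` W" using S by (auto simp: W_def)
    then have "ball ((1/2) *\<^sub>R v) 1 \<subseteq> (\<Union>w\<in>W. ball ((1/2) *\<^sub>R w) (1 + \<delta>))"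
      using cover v by (auto simp: points_def dilate_def b_def)
    moreover have "\<not> ball ((1/2) *\<^sub>R v) 1 \<subseteq> (\<Union>w\<in>W. ball ((1/2) *\<^sub>R w) (1 + \<delta>))"
    proof (rule half_vector_ball_needed[OF \<delta> V(3)[OF v]])
      fix w assume w: "w \<in> W"
      then show "norm w = 1" using V(3) by (simp add: W_def)
      have "1 / (real CARD('n) * real m) \<le> dist v w"
        by (rule V(4)[OF v]) (use w \<open>b v \<notin> S\<close> in \<open>auto simp: W_def\<close>)
      then have "(1 / (real CARD('n) * real m))\<^sup>2 \<le> (dist v w)\<^sup>2" by (intro power_mono) auto
      then show "6 * \<delta> \<le> (dist v w)\<^sup>2" by (simp add: \<delta>_def power_divide)
    qed
    ultimately show False by blast
  qed
  then have S_eq: "S = b ` V" using S by blast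
  have "(\<Sum>B\<in>S. indicator (points B) (0 :: real ^ 'n)) = (\<Sum>B\<in>S. 1 :: real)"
    by (rule sum.cong) (auto simp: S_eq b_def points_def V(3))
  also have "\<dots> = real m ^ (CARD('n) - 1)"
    using V(2) by (simp add: S_eq card_image inj_on_subset[OF inj])
  finally show ?thesis using bound[of 0] by simp
qed

text \<open>With \<open>\<delta>\<close> of order \<open>m powr (-2)\<close>, the overlap
  \<open>m ^ (n - 1)\<close> would be at most a constant times \<open>m powr (2 * \<tau>)\<close>,
  which fails for large \<open>m\<close> as \<open>2 * \<tau> < n - 1\<close>.\<close>

lemma exponent_optimal:
  fixes \<tau> A :: real
  assumes \<tau>: "\<tau> < (real CARD('n::finite) - 1) / 2"
    and selection: "\<And>\<delta> \<B>. 0 < \<delta> \<Longrightarrow> \<delta> < 1/2 \<Longrightarrow> finite_ball_family (\<B> :: 'n eball set) \<Longrightarrow> equal_radii \<B> \<Longrightarrow>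
      \<exists>\<S>\<subseteq>\<B>. (\<Union>B\<in>\<B>. points B) \<subseteq> (\<Union>B\<in>\<S>. points (dilate (1 + \<delta>) B)) \<and>
        (\<forall>x. (\<Sum>B\<in>\<S>. indicator (points B) x) \<le> A * \<delta> powr (- \<tau>))"
  shows False
proof -
  define n where "n = CARD('n)"
  have n: "0 < n" by (simp add: n_def)
  define e where "e = real (n - 1) - 2 * \<tau>"
  have e: "0 < e" using \<tau> n by (simp add: e_def n_def of_nat_diff Suc_leI)
  define C where "C = \<bar>A\<bar> * (6 * (real n)\<^sup>2) powr \<tau>"
  have C: "0 \<le> C" by (simp add: C_def)
  \<comment> \<open>Chosen so that \<open>m powr e\<close> exceeds \<open>C\<close>, where
    \<open>e\<close> is the gap between the two exponents; the added 1 makes the inequality strict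
    and \<open>m\<close> positive.\<close>
  define m where "m = nat \<lceil>C powr (1 / e)\<rceil> + 1"
  have m: "0 < m" "C powr (1 / e) < real m" unfolding m_def by linarith+
  define \<delta> where "\<delta> = 1 / (6 * (real n * real m)\<^sup>2)"
  have nm: "1 \<le> real n * real m" using n m by (simp add: Suc_leI flip: of_nat_mult)
  have "1 \<le> (real n * real m)\<^sup>2" using nm by (rule one_le_power)
  then have \<delta>: "0 < \<delta>" "\<delta> < 1/2" by (auto simp: \<delta>_def field_simps)
  have "real m ^ (n - 1) \<le> A * \<delta> powr (- \<tau>)"
    unfolding n_def
    by (rule overlap_lower_bound[OF m(1), where \<delta> = \<delta>, OF _ selection[OF \<delta>]])
       (auto simp: \<delta>_def n_def)
  also have "\<dots> \<le> \<bar>A\<bar> * \<delta> powr (- \<tau>)" by (intro mult_right_mono) auto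
  also have "\<delta> powr (- \<tau>) = (6 * (real n)\<^sup>2) powr \<tau> * real m powr (2 * \<tau>)"
  proof -
    have "\<delta> powr (- \<tau>) = (6 * (real n * real m)\<^sup>2) powr \<tau>"
      using nm by (simp add: \<delta>_def powr_divide powr_minus)
    also have "6 * (real n * real m)\<^sup>2 = (6 * (real n)\<^sup>2) * (real m)\<^sup>2" by (simp add: power_mult_distrib)
    also have "\<dots> powr \<tau> = (6 * (real n)\<^sup>2) powr \<tau> * ((real m)\<^sup>2) powr \<tau>" by (rule powr_mult)
    also have "((real m)\<^sup>2) powr \<tau> = real m powr (2 * \<tau>)"
      using m by (simp add: powr_powr flip: powr_numeral)
    finally show ?thesis .
  qed
  finally have "real m powr real (n - 1) \<le> C * real m powr (2 * \<tau>)"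
    using m by (simp add: C_def powr_realpow mult.assoc)
  moreover have "real m powr real (n - 1) = real m powr e * real m powr (2 * \<tau>)"
    by (simp add: e_def flip: powr_add)
  ultimately have "real m powr e \<le> C" using m by simp
  moreover have "(C powr (1 / e)) powr e < real m powr e"
    using m(2) e by (intro powr_less_mono2) auto
  moreover have "(C powr (1 / e)) powr e = C" using e C by (simp add: powr_powr)
  ultimately show False by linarith
qed

theorem theorem1:
  fixes \<sigma> :: real
  assumes "CARD('n::finite) \<ge> 2"
    and "\<sigma> = (real CARD('n) - 1) / 2"
  shows
    "(\<exists>A>0. \<forall>\<delta>::real. 0 < \<delta> \<and> \<delta> < 1/2 \<longrightarrow>
       (\<forall>\<B> :: 'n eball set. finite_ball_family \<B> \<longrightarrow>
         (\<exists>\<S>\<subseteq>\<B>.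
            (\<Union>B\<in>\<B>. points B) \<subseteq> (\<Union>B\<in>\<S>. points (dilate (1 + \<delta>) B)) \<and>
            (\<forall>x. (\<Sum>B\<in>\<S>. indicator (points B) x) \<le> A * \<delta> powr (- \<sigma>)))))
     \<and>
     \<not> (\<exists>\<tau> A :: real. \<tau> < \<sigma> \<and> A > 0 \<and> (\<forall>\<delta>::real. 0 < \<delta> \<and> \<delta> < 1/2 \<longrightarrow>
       (\<forall>\<B> :: 'n eball set. finite_ball_family \<B> \<and> equal_radii \<B> \<longrightarrow>
         (\<exists>\<S>\<subseteq>\<B>.
            (\<Union>B\<in>\<B>. points B) \<subseteq> (\<Union>B\<in>\<S>. points (dilate (1 + \<delta>) B)) \<and>
            (\<forall>x. (\<Sum>B\<in>\<S>. indicator (points B) x) \<le> A * \<delta> powr (- \<tau>))))))"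
proof (rule conjI)
  show "\<exists>A>0. \<forall>\<delta>::real. 0 < \<delta> \<and> \<delta> < 1/2 \<longrightarrow>
       (\<forall>\<B> :: 'n eball set. finite_ball_family \<B> \<longrightarrow>
         (\<exists>\<S>\<subseteq>\<B>.
            (\<Union>B\<in>\<B>. points B) \<subseteq> (\<Union>B\<in>\<S>. points (dilate (1 + \<delta>) B)) \<and>
            (\<forall>x. (\<Sum>B\<in>\<S>. indicator (points B) x) \<le> A * \<delta> powr (- \<sigma>))))"
    unfolding assms(2) by (rule ex_bounded_overlap_selection[OF assms(1)])
next
  show "\<not> (\<exists>\<tau> A :: real. \<tau> < \<sigma> \<and> A > 0 \<and> (\<forall>\<delta>::real. 0 < \<delta> \<and> \<delta> < 1/2 \<longrightarrow>
       (\<forall>\<B> :: 'n eball set. finite_ball_family \<B> \<and> equal_radii \<B> \<longrightarrow>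
         (\<exists>\<S>\<subseteq>\<B>.
            (\<Union>B\<in>\<B>. points B) \<subseteq> (\<Union>B\<in>\<S>. points (dilate (1 + \<delta>) B)) \<and>
            (\<forall>x. (\<Sum>B\<in>\<S>. indicator (points B) x) \<le> A * \<delta> powr (- \<tau>))))))"
  proof
    assume "\<exists>\<tau> A :: real. \<tau> < \<sigma> \<and> A > 0 \<and> (\<forall>\<delta>::real. 0 < \<delta> \<and> \<delta> < 1/2 \<longrightarrow>
       (\<forall>\<B> :: 'n eball set. finite_ball_family \<B> \<and> equal_radii \<B> \<longrightarrow>
         (\<exists>\<S>\<subseteq>\<B>.
            (\<Union>B\<in>\<B>. points B) \<subseteq> (\<Union>B\<in>\<S>. points (dilate (1 + \<delta>) B)) \<and>
            (\<forall>x. (\<Sum>B\<in>\<S>. indicator (points B) x) \<le> A * \<delta> powr (- \<tau>)))))"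
    then obtain \<tau> A :: real where "\<tau> < \<sigma>" and selection: "\<forall>\<delta>::real. 0 < \<delta> \<and> \<delta> < 1/2 \<longrightarrow>
       (\<forall>\<B> :: 'n eball set. finite_ball_family \<B> \<and> equal_radii \<B> \<longrightarrow>
         (\<exists>\<S>\<subseteq>\<B>.
            (\<Union>B\<in>\<B>. points B) \<subseteq> (\<Union>B\<in>\<S>. points (dilate (1 + \<delta>) B)) \<and>
            (\<forall>x. (\<Sum>B\<in>\<S>. indicator (points B) x) \<le> A * \<delta> powr (- \<tau>))))"
      by (elim exE conjE)
    have "\<tau> < (real CARD('n) - 1) / 2" using \<open>\<tau> < \<sigma>\<close> assms(2) by simp
    then show False
    proof (rule exponent_optimal)
      fix \<delta> :: real and \<B> :: "'n eball set"
      assume "0 < \<delta>" "\<delta> < 1/2" "finite_ball_family \<B>" "equal_radii \<B>"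
      then show "\<exists>\<S>\<subseteq>\<B>. (\<Union>B\<in>\<B>. points B) \<subseteq> (\<Union>B\<in>\<S>. points (dilate (1 + \<delta>) B)) \<and>
          (\<forall>x. (\<Sum>B\<in>\<S>. indicator (points B) x) \<le> A * \<delta> powr (- \<tau>))"
        by (intro selection[THEN spec, THEN mp, THEN spec, THEN mp] conjI)
    qed
  qed
qed

end
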